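(* Let $B>1$, let $\{E_{jk}\}_{k=1}^{N_j}$ ($j\in\mathbb{Z}$) be partitions of $\mathbb{S}^2$ into regions of area $\lambda_{jk}$ with points $\xi_{jk}\in E_{jk}$, let $\mathcal{J}\subset\mathbb{Z}$ be the set of admissible levels, let $s\in\mathbb{N}$, and let $\Psi_{jk;s}$ be the associated Mexican needlets (all as defined in the context). Then for every $p\in[1,\infty)$ there exist constants $c_p,C_p>0$ such that, for all $j\in\mathcal{J}$ and all $k=1,\ldots,N_j$, $$c_p\,B^{2j\left(\frac12-\frac1p\right)}\le\left\|\Psi_{jk;s}\right\|_{L^p(\mathbb{S}^2)}\le C_p\,B^{2j\left(\frac12-\frac1p\right)}.$$ Furthermore, there exist constants $c_\infty,C_\infty>0$ such that, for all $j\in\mathcal{J}$ and all $k=1,\ldots,N_j$, $$c_\infty B^{j}\le\left\|\Psi_{jk;s}\right\|_{L^\infty(\mathbb{S}^2)}\le C_\infty B^{j}.$$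
   Context: $\mathbb{N}=\{1,2,\ldots\}$. $\mathbb{S}^2\subset\mathbb{R}^3$ is the unit sphere with its surface area measure (total mass $4\pi$), with respect to which the $L^p$ norms are taken. $P_\ell$ is the Legendre polynomial of degree $\ell$, $P_\ell(u)=\frac{1}{2^\ell \ell!}\frac{d^\ell}{du^\ell}(u^2-1)^\ell$. Partitions: for a fixed $B>1$ and each integer resolution level $j$, $\{E_{jk}\}_{k=1}^{N_j}$ is a finite family of pairwise disjoint measurable subsets of $\mathbb{S}^2$ with union $\mathbb{S}^2$; $E_{jk}$ has diameter at most $c_B B^{-j}$ (with $c_B>0$ fixed) and area $\lambda_{jk}$, and a point $\xi_{jk}\in E_{jk}$ is chosen. Constants $0<c'\le c''$ are fixed, and $\mathcal{J}\subset\mathbb{Z}$ denotes the set of levels $j$ for which $c'B^{-2j}\le\lambda_{jk}\le c''B^{-2j}$ for all $k=1,\ldots,N_j$ (so that also $N_j$ is comparable to $B^{2j}$). The partitions, $B$, $c_B$, $c'$, $c''$ and $s$ are regarded as fixed; constants may depend on them, but not on $j$ or $k$. Weight function: $f_s(t)=t^{2s}e^{-t^2}$, $t\in\mathbb{R}$. Mexican needlets: with $\vartheta=\vartheta_{jk}(x)\in[0,\pi]$ the geodesic distance between $x$ and $\xi_{jk}$ (so $\cos\vartheta$ is the Euclidean inner product of $x$ and $\xi_{jk}$), $$\Psi_{jk;s}(x)=\sqrt{\lambda_{jk}}\,\frac{1}{2\pi}\sum_{\ell=0}^{\infty}f_s\!\left(\frac{\ell+\frac12}{B^j}\right)\left(\ell+\tfrac12\right)P_\ell(\cos\vartheta).$$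 *)

theory Defs
  imports "HOL-Analysis.Analysis" "HOL-Probability.Essential_Supremum"
begin

section \<open>Surface measure of the unit sphere\<close>

text \<open>
  The surface area measure is the one from integration in polar coordinates in dimension 3,
  \<open>\<sigma>(A) = 3 * vol {x. 0 < |x| < 1 \<and> x / |x| \<in> A}\<close>, where the factor 3 comes from
  \<open>\<integral>\<^sub>0\<^sup>1 r\<^sup>2 dr = 1/3\<close>.  It is completed, so the measurable sets are the Lebesgue
  (not only the Borel) measurable subsets of the sphere.  The lemmas below record the total mass
  \<open>4 \<pi>\<close> and the rotation invariance, which together characterise it.
\<close>

definition sphere_measure :: "(real^3) measure" where
  "sphere_measure =
     completion (distr (scale_measure 3 (restrict_space lborel (ball 0 1 - {0})))
                       (restrict_space borel (sphere 0 1)) sgn)"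

lemma space_sphere_measure [simp]: "space sphere_measure = sphere 0 1"
  by (simp add: sphere_measure_def space_restrict_space)

lemma sets_borel_sphere_measure:
  assumes "A \<in> sets borel" "A \<subseteq> sphere 0 1"
  shows "A \<in> sets sphere_measure"
  unfolding sphere_measure_def using assms
  by (auto intro!: sets_completionI_sets simp: sets_restrict_space_iff)

lemma sgn_measurable_sphere:
  "(sgn :: real^3 \<Rightarrow> _) \<in>
     scale_measure r (restrict_space lborel (ball 0 1 - {0})) \<rightarrow>\<^sub>M restrict_space borel (sphere 0 1)"
proof -
  have "(\<lambda>x::real^3. inverse (norm x) *\<^sub>R x) \<in> borel_measurable lborel"
    by measurable
  then have "(sgn :: real^3 \<Rightarrow> _) \<in> borel_measurable (restrict_space lborel (ball 0 1 - {0}))"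
    unfolding sgn_div_norm by (rule measurable_restrict_space1)
  then show ?thesis
    by (subst measurable_cong_sets[OF sets_scale_measure refl])
       (auto intro!: measurable_restrict_space2 simp: space_restrict_space norm_sgn)
qed

lemma emeasure_sphere_measure_borel:
  assumes "A \<in> sets borel" "A \<subseteq> sphere 0 1"
  shows "emeasure sphere_measure A = 3 * emeasure lborel {x \<in> ball 0 1 - {0}. sgn x \<in> A}"
proof -
  have "A \<in> sets (restrict_space borel (sphere (0::real^3) 1))"
    using assms by (auto simp: sets_restrict_space_iff)
  moreover have "sgn -` A \<inter> (ball 0 1 - {0}) = {x \<in> ball 0 1 - {0}. sgn x \<in> A}"
    by auto
  moreover have "emeasure (restrict_space lborel (ball 0 1 - {0})) {x \<in> ball 0 1 - {0}. sgn x \<in> A}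
      = emeasure lborel {x \<in> ball 0 1 - {0}. sgn x \<in> A}"
    by (rule emeasure_restrict_space) auto
  ultimately show ?thesis
    unfolding sphere_measure_def
    by (simp add: emeasure_distr[OF sgn_measurable_sphere] space_scale_measure space_restrict_space)
qed

lemma emeasure_sphere_measure_sphere: "emeasure sphere_measure (sphere 0 1) = ennreal (4 * pi)"
proof -
  have "{x \<in> ball 0 1 - {0}. sgn x \<in> sphere (0::real^3) 1} = ball 0 1 - {0}"
    by (auto simp: norm_sgn)
  moreover have "emeasure lborel (ball 0 1 - {0 :: real^3}) = emeasure lborel (ball (0::real^3) 1)"
    by (rule emeasure_Diff_null_set) (auto simp: null_sets_def)
  moreover have "emeasure lborel (ball (0::real^3) 1) = ennreal (4 / 3 * pi)"
    by (simp add: emeasure_ball unit_ball_vol_3)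
  moreover have "3 * ennreal (4 / 3 * pi) = ennreal (4 * pi)"
    by (subst ennreal_numeral[symmetric], subst ennreal_mult[symmetric]) auto
  ultimately show ?thesis
    by (subst emeasure_sphere_measure_borel) auto
qed

lemma emeasure_sphere_measure_rotation:
  assumes "orthogonal_transformation T" "A \<in> sets borel" "A \<subseteq> sphere 0 1"
  shows "emeasure sphere_measure (T ` A) = emeasure sphere_measure A"
proof -
  let ?S = "{x \<in> ball 0 1 - {0}. sgn x \<in> A}"
  have T: "linear T" "\<And>x. norm (T x) = norm x" "bij T" "orthogonal_transformation (inv T)"
    using assms(1) orthogonal_transformation_linear orthogonal_transformation_norm
      orthogonal_transformation_bij orthogonal_transformation_inv by auto
  have vi: "T ` B = inv T -` B" for B
    using bij_vimage_eq_inv_image[of "inv T" B] T(3) by (simp add: bij_imp_bij_inv inv_inv_eq)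
  have "continuous_on UNIV (inv T)"
    using T(4) by (simp add: linear_continuous_on orthogonal_transformation_linear
        linear_conv_bounded_linear[symmetric])
  then have "inv T \<in> borel_measurable borel"
    by (rule borel_measurable_continuous_onI)
  then have TA: "T ` A \<in> sets borel"
    unfolding vi using measurable_sets[OF _ assms(2), of "inv T" borel] by simp
  have TA': "T ` A \<subseteq> sphere 0 1"
    using assms(3) T(2) by auto
  have "(\<lambda>x::real^3. inverse (norm x) *\<^sub>R x) \<in> borel_measurable borel"
    by measurable
  then have "(sgn :: real^3 \<Rightarrow> _) \<in> borel_measurable borel"
    unfolding sgn_div_norm .
  then have "sgn -` A \<in> sets borel"
    using measurable_sets[OF _ assms(2), of sgn borel] by simp
  moreover have "?S = (ball 0 1 - {0}) \<inter> sgn -` A"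
    by auto
  ultimately have S: "?S \<in> sets borel"
    by simp
  have Sm: "?S \<in> lmeasurable"
    by (rule bounded_set_imp_lmeasurable) (use S in \<open>auto intro: bounded_subset[OF bounded_ball[of 0 1]]\<close>)
  have sgnT: "sgn (T x) = T (sgn x)" for x
    using T by (simp add: sgn_div_norm linear_scale)
  have nz: "T x = 0 \<longleftrightarrow> x = 0" for x
    using T(2)[of x] by (metis norm_eq_zero)
  have eqS: "{x \<in> ball 0 1 - {0}. sgn x \<in> T ` A} = T ` ?S"
  proof (intro set_eqI iffI)
    fix y assume y: "y \<in> {x \<in> ball 0 1 - {0}. sgn x \<in> T ` A}"
    obtain x where x: "y = T x"
      using T(3) by (metis bij_pointE)
    have "T (sgn x) \<in> T ` A"
      using y by (simp add: x sgnT)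
    then have "sgn x \<in> A"
      using T(3) by (simp add: bij_is_inj inj_image_mem_iff)
    then show "y \<in> T ` ?S"
      using y T(2) nz unfolding x by auto
  qed (use T(2) nz sgnT in auto)
  have "\<bar>det (matrix T)\<bar> = 1"
    using assms(1) det_orthogonal_matrix orthogonal_transformation_matrix by fastforce
  then have "measure lebesgue (T ` ?S) = measure lebesgue ?S" and TSm: "T ` ?S \<in> lmeasurable"
    using measure_linear_image[OF T(1) Sm] measurable_linear_image[OF T(1) Sm] by auto
  then have "emeasure lebesgue (T ` ?S) = emeasure lebesgue ?S"
    using Sm by (simp add: emeasure_eq_measure2)
  moreover have "T ` ?S \<in> sets borel"
    unfolding vi using measurable_sets[OF \<open>inv T \<in> borel_measurable borel\<close> S] by simp
  ultimately have "emeasure lborel (T ` ?S) = emeasure lborel ?S"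
    using S by simp
  then show ?thesis
    by (simp only: emeasure_sphere_measure_borel[OF TA TA'] emeasure_sphere_measure_borel[OF assms(2,3)] eqS)
qed

section \<open>Lebesgue norms\<close>

text \<open>As for \<^const>\<open>esssup\<close>, the value is \<open>\<infinity>\<close> for functions outside the space.\<close>

definition Lp_norm :: "'a measure \<Rightarrow> real \<Rightarrow> ('a \<Rightarrow> real) \<Rightarrow> ennreal" where
  "Lp_norm M p f =
     (if f \<in> borel_measurable M \<and> integrable M (\<lambda>x. \<bar>f x\<bar> powr p)
      then ennreal ((\<integral>x. \<bar>f x\<bar> powr p \<partial>M) powr (1 / p)) else \<infinity>)"

definition Linf_norm :: "'a measure \<Rightarrow> ('a \<Rightarrow> real) \<Rightarrow> ennreal" where
  "Linf_norm M f = esssup M (\<lambda>x. ennreal \<bar>f x\<bar>)"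

section \<open>Mexican needlets\<close>

definition legendre :: "nat \<Rightarrow> real poly" where
  "legendre l = smult (1 / (2 ^ l * fact l)) ((pderiv ^^ l) ([:-1, 0, 1:] ^ l))"

definition mexican_weight :: "nat \<Rightarrow> real \<Rightarrow> real" where
  "mexican_weight s t = t ^ (2 * s) * exp (- (t\<^sup>2))"

text \<open>
  For \<open>x\<close> and \<open>\<xi>\<close> on the sphere, \<open>x \<bullet> \<xi>\<close> is the cosine of their geodesic distance.
\<close>

definition mexican_needlet ::
  "real \<Rightarrow> nat \<Rightarrow> (int \<Rightarrow> nat \<Rightarrow> (real^3) set) \<Rightarrow> (int \<Rightarrow> nat \<Rightarrow> real^3) \<Rightarrow> int \<Rightarrow> nat \<Rightarrow> real^3 \<Rightarrow> real"
where
  "mexican_needlet B s E \<xi> j k x =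
     sqrt (measure sphere_measure (E j k)) * (1 / (2 * pi)) *
     (\<Sum>l. mexican_weight s ((real l + 1/2) / B powi j) * (real l + 1/2) *
           poly (legendre l) (x \<bullet> \<xi> j k))"

definition admissible_levels ::
  "real \<Rightarrow> real \<Rightarrow> real \<Rightarrow> (int \<Rightarrow> nat) \<Rightarrow> (int \<Rightarrow> nat \<Rightarrow> (real^3) set) \<Rightarrow> int set"
where
  "admissible_levels B c' c'' N E =
     {j. \<forall>k\<in>{1..N j}. c' * B powi (- 2 * j) \<le> measure sphere_measure (E j k) \<and>
                      measure sphere_measure (E j k) \<le> c'' * B powi (- 2 * j)}"

end

theory Submission
  imports Defs
begin

text \<open>
  Put \<open>R = B\<^sup>j\<close>; admissibility bounds \<open>R\<close> from below, since the area of a region is at most \<open>4 \<pi>\<close>.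
  Up to a factor comparable to \<open>1 / R\<close> the needlet is the zonal kernel
  \<open>K(u) = \<Sum>\<^sub>l f\<^sub>s((l + 1/2) / R) (l + 1/2) P\<^sub>l(u)\<close> at \<open>u = x \<bullet> \<xi>\<close>, and integrals of zonal functions over
  the sphere are \<open>2 \<pi>\<close> times integrals over \<open>[-1, 1]\<close>.  Three estimates determine all norms.
  As \<open>|P\<^sub>l| \<le> 1\<close>, the kernel is \<open>O(R\<^sup>2)\<close>.  Its \<open>L\<^sup>1\<close> norm is \<open>O(1)\<close>: by orthogonality
  \<open>\<parallel>K\<parallel>\<^sub>2 = O(R)\<close>, and multiplication by \<open>1 - u\<close> acts on the coefficients as a second difference,
  so that \<open>\<parallel>(1 - u) K\<parallel>\<^sub>2 = O(1 / R)\<close>; Cauchy--Schwarz with the weight \<open>1 + R\<^sup>2 (1 - u)\<close> concludes.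
  Finally \<open>P\<^sub>l(u) \<ge> 1 - (l + 1/2)\<^sup>2 (1 - u)\<close> gives \<open>K \<ge> c R\<^sup>2\<close> on a cap of area comparable
  to \<open>R\<^sup>-\<^sup>2\<close>.
\<close>

section \<open>Legendre polynomials\<close>

text \<open>The obstacle is the range p < 2. On a set of finite measure the bound
  \<open>O(R)\<close> for the L2 norm of the kernel gives only \<open>O(R)\<close> for its L1 norm,
  a factor \<open>R\<close> too much: the mass has to be localised at the scale where
  \<open>1 - u\<close> is of order \<open>R^-2\<close>. Doing this in L2 avoids all asymptotics of
  Legendre polynomials, since the three-term recurrence turns multiplication by \<open>u\<close>
  into shifts of the coefficients. With the L1 and sup bounds at hand every exponent follows by
  interpolation, and the cap alone gives the matching lower bound; both estimates put the integral
  of the p-th power of a needlet at size \<open>R^(p-2)\<close>. The lower bound on \<open>R\<close>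
  is essential: as \<open>R\<close> tends to 0 the Gaussian factors make the kernel smaller than any
  power of \<open>R\<close>. The half-integers matter too: they make the differences of the
  coefficients symmetric, and \<open>1 / (l + 1/2)\<close> is the squared L2 norm of the Legendre
  polynomial of degree \<open>l\<close> on [-1, 1].\<close>

lemma higher_pderiv_times_X:
  fixes p :: "real poly"
  shows "(pderiv ^^ Suc n) ([:0, 1:] * p) =
    [:0, 1:] * (pderiv ^^ Suc n) p + of_nat (Suc n) * (pderiv ^^ n) p"
proof (induction n)
  case 0
  show ?case by (simp add: pderiv_mult pderiv_pCons)
next
  case (Suc n)
  have "(pderiv ^^ Suc (Suc n)) ([:0, 1:] * p) = pderiv ((pderiv ^^ Suc n) ([:0, 1:] * p))"
    by simp
  also have "\<dots> = [:0, 1:] * (pderiv ^^ Suc (Suc n)) p + of_nat (Suc (Suc n)) * (pderiv ^^ Suc n) p"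
    unfolding Suc.IH by (simp add: pderiv_add pderiv_mult pderiv_pCons algebra_simps
        del: mult_pCons_left mult_pCons_right flip: one_pCons)
  finally show ?case .
qed

lemma pderiv_of_nat_mult: "pderiv (of_nat k * p) = of_nat k * pderiv (p :: real poly)"
  by (simp add: of_nat_poly pderiv_smult)

text \<open>Leibniz's rule stops after three terms because the weight is quadratic. Applied to a
  power of that weight, it makes Rodrigues' formula yield a differential equation.\<close>

lemma higher_pderiv_weight_times_pderiv:
  fixes p :: "real poly"
  shows "(pderiv ^^ Suc n) ([:-1, 0, 1:] * pderiv p) =
    [:-1, 0, 1:] * (pderiv ^^ Suc (Suc n)) p
      + of_nat (2 * Suc n) * ([:0, 1:] * (pderiv ^^ Suc n) p)
      + of_nat (Suc n * n) * (pderiv ^^ n) p"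
proof (induction n)
  case 0
  have w: "pderiv [:-1, 0, 1:] = of_nat 2 * ([:0, 1:] :: real poly)"
    by (simp add: pderiv_pCons numeral_poly)
  show ?case unfolding funpow.simps o_def id_apply pderiv_mult[of "[:-1, 0, 1:]"] w
    by (simp add: algebra_simps del: mult_pCons_left mult_pCons_right)
next
  case (Suc n)
  have w: "pderiv [:-1, 0, 1:] = of_nat 2 * ([:0, 1:] :: real poly)"
    by (simp add: pderiv_pCons numeral_poly)
  have x: "pderiv ([:0, 1:] :: real poly) = 1"
    by (simp add: pderiv_pCons)
  have "(pderiv ^^ Suc (Suc n)) ([:-1, 0, 1:] * pderiv p) =
      pderiv ((pderiv ^^ Suc n) ([:-1, 0, 1:] * pderiv p))"
    by simp
  also have "\<dots> = [:-1, 0, 1:] * (pderiv ^^ Suc (Suc (Suc n))) p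
      + of_nat (2 * Suc (Suc n)) * ([:0, 1:] * (pderiv ^^ Suc (Suc n)) p)
      + of_nat (Suc (Suc n) * Suc n) * (pderiv ^^ Suc n) p"
    unfolding Suc.IH pderiv_add pderiv_mult[of "[:-1, 0, 1:]"] pderiv_mult[of "[:0, 1:]"] pderiv_of_nat_mult w x
    by (simp add: algebra_simps
        del: mult_pCons_left mult_pCons_right flip: one_pCons)
  finally show ?case .
qed

abbreviation leg :: "nat \<Rightarrow> real \<Rightarrow> real" where
  "leg n \<equiv> poly (legendre n)"

abbreviation leg' :: "nat \<Rightarrow> real \<Rightarrow> real" where
  "leg' n \<equiv> poly (pderiv (legendre n))"

lemma legendre_0: "legendre 0 = 1"
  by (simp add: legendre_def)

lemma legendre_1: "legendre (Suc 0) = [:0, 1:]"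
  by (simp add: legendre_def pderiv_pCons)

text \<open>\<open>r\<close> is one derivative short of Rodrigues' formula, hence up to a constant
  an antiderivative of the polynomial of degree \<open>Suc n\<close>. The third identity comes from
  differentiating \<open>w * (w^m)' = 2 m x w^m\<close> with \<open>w = x^2 - 1\<close> and
  \<open>m = Suc n\<close>. The two derivative recurrences below eliminate \<open>r\<close>: one by
  differentiating the first identity, the other by substituting the third into it.\<close>

lemma legendre_rodrigues_step:
  fixes n :: nat
  defines "r \<equiv> (pderiv ^^ n) ([:-1, 0, 1 :: real:] ^ Suc n)"
  defines "c \<equiv> 1 / (2 ^ Suc n * fact (Suc n)) :: real"
  shows "legendre (Suc (Suc n)) = [:0, 1:] * legendre (Suc n) + smult (c * real (Suc n)) r"
    and "legendre (Suc n) = smult c (pderiv r)"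
    and "[:-1, 0, 1:] * pderiv (pderiv r) = of_nat (Suc n * Suc (Suc n)) * r"
proof -
  let ?w = "[:-1, 0, 1 :: real:]"
  have dw: "pderiv ?w = of_nat 2 * [:0, 1:]"
    by (simp add: pderiv_pCons numeral_poly)
  have dwn: "pderiv (?w ^ Suc m) = of_nat (2 * Suc m) * ([:0, 1:] * ?w ^ m)" for m
  proof -
    have "smult (of_nat k) q = of_nat k * q" for k and q :: "real poly"
      by (simp add: of_nat_poly)
    then show ?thesis
      unfolding pderiv_power_Suc dw of_nat_mult by (simp only: mult_ac)
  qed
  have of_nat_D: "(pderiv ^^ k) (of_nat m * p) = of_nat m * (pderiv ^^ k) (p :: real poly)" for k m p
    by (induction k) (simp_all add: pderiv_of_nat_mult)
  have "(pderiv ^^ Suc (Suc n)) (?w ^ Suc (Suc n)) = (pderiv ^^ Suc n) (pderiv (?w ^ Suc (Suc n)))"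
    by (simp add: funpow_swap1)
  also have "\<dots> = of_nat (2 * Suc (Suc n)) *
      ([:0, 1:] * (pderiv ^^ Suc n) (?w ^ Suc n) + of_nat (Suc n) * r)"
    unfolding dwn of_nat_D higher_pderiv_times_X r_def ..
  finally have *: "(pderiv ^^ Suc (Suc n)) (?w ^ Suc (Suc n)) = \<dots>" .
  \<comment> \<open>Differentiating the power once produces \<open>2 * Suc (Suc n)\<close>, exactly
    the ratio of consecutive normalising factors.\<close>
  have c: "1 / (2 ^ Suc (Suc n) * fact (Suc (Suc n))) * real (2 * Suc (Suc n)) = c"
    unfolding c_def by (simp add: divide_simps del: of_nat_Suc) (simp add: algebra_simps)
  have om: "of_nat m * p = smult (real m) p" for m and p :: "real poly"
    by (simp add: of_nat_poly)
  show 2: "legendre (Suc n) = smult c (pderiv r)"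
    by (simp add: legendre_def c_def r_def)
  have "legendre (Suc (Suc n)) = smult c ([:0, 1:] * (pderiv ^^ Suc n) (?w ^ Suc n) + of_nat (Suc n) * r)"
    unfolding legendre_def * om smult_smult c ..
  then show "legendre (Suc (Suc n)) = [:0, 1:] * legendre (Suc n) + smult (c * real (Suc n)) r"
    unfolding 2 om r_def by (simp add: smult_add_right del: mult_pCons_left mult_pCons_right of_nat_Suc)
  have "?w * pderiv (?w ^ Suc n) = of_nat (2 * Suc n) * ([:0, 1:] * ?w ^ Suc n)"
    unfolding dwn by (simp add: algebra_simps del: mult_pCons_left mult_pCons_right of_nat_Suc)
  then have "(pderiv ^^ Suc n) (?w * pderiv (?w ^ Suc n)) =
      (pderiv ^^ Suc n) (of_nat (2 * Suc n) * ([:0, 1:] * ?w ^ Suc n))"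
    by simp
  then have "?w * pderiv (pderiv r) + of_nat (2 * Suc n) * ([:0, 1:] * pderiv r) + of_nat (Suc n * n) * r
      = of_nat (2 * Suc n) * ([:0, 1:] * pderiv r + of_nat (Suc n) * r)"
    unfolding higher_pderiv_weight_times_pderiv of_nat_D higher_pderiv_times_X r_def
    by simp
  then have "?w * pderiv (pderiv r) + of_nat (Suc n * n) * r
      = of_nat (2 * Suc n) * (of_nat (Suc n) * r)"
    by (simp only: distrib_left)
  moreover have "of_nat (2 * Suc n) * (of_nat (Suc n) * r) = of_nat (Suc n * n) * r + of_nat (Suc n * Suc (Suc n)) * r"
    by (simp add: algebra_simps)
  ultimately show "?w * pderiv (pderiv r) = of_nat (Suc n * Suc (Suc n)) * r"
    by simp
qed

section \<open>Recurrences and the Legendre differential equation\<close>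

lemma leg_0 [simp]: "leg 0 x = 1"
  by (simp add: legendre_0)

lemma legendre_pderiv_Suc: "leg' (Suc n) x = real (Suc n) * leg n x + x * leg' n x"
proof (cases n)
  case 0
  then show ?thesis by (simp add: legendre_0 legendre_1 pderiv_pCons)
next
  case (Suc m)
  define r where "r = (pderiv ^^ m) ([:-1, 0, 1 :: real:] ^ Suc m)"
  define c :: real where "c = 1 / (2 ^ Suc m * fact (Suc m))"
  note s = legendre_rodrigues_step[of m, folded r_def c_def]
  have "leg' (Suc (Suc m)) x = leg (Suc m) x + x * leg' (Suc m) x + real (Suc m) * (c * poly (pderiv r) x)"
    unfolding s(1) by (simp add: pderiv_add pderiv_mult pderiv_smult pderiv_pCons algebra_simps)
  also have "c * poly (pderiv r) x = leg (Suc m) x"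
    unfolding s(2) by simp
  finally show ?thesis
    unfolding Suc by (simp add: algebra_simps)
qed

lemma legendre_Suc: "real (Suc n) * leg (Suc n) x = real (Suc n) * x * leg n x + (x\<^sup>2 - 1) * leg' n x"
proof (cases n)
  case 0
  then show ?thesis by (simp add: legendre_0 legendre_1)
next
  case (Suc m)
  define r where "r = (pderiv ^^ m) ([:-1, 0, 1 :: real:] ^ Suc m)"
  define c :: real where "c = 1 / (2 ^ Suc m * fact (Suc m))"
  note s = legendre_rodrigues_step[of m, folded r_def c_def]
  have "poly ([:-1, 0, 1:] * pderiv (pderiv r)) x = real (Suc m * Suc (Suc m)) * poly r x"
    unfolding s(3) by simp
  then have "(x\<^sup>2 - 1) * poly (pderiv (pderiv r)) x = real (Suc m * Suc (Suc m)) * poly r x"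
    by (simp add: power2_eq_square algebra_simps)
  then have "(x\<^sup>2 - 1) * leg' (Suc m) x = c * (real (Suc m * Suc (Suc m)) * poly r x)"
    unfolding s(2) by (simp add: pderiv_smult)
  then show ?thesis
    unfolding Suc s(1) by (simp add: algebra_simps)
qed

text \<open>The derivatives are eliminated from \<open>legendre_pderiv_Suc\<close> and
  \<open>legendre_Suc\<close>, the latter taken in two consecutive degrees. At \<open>n = 0\<close>
  the truncated index \<open>n - 1\<close> is harmless, its coefficient being 0.\<close>

lemma legendre_recurrence:
  "real (2 * n + 1) * x * leg n x = real (Suc n) * leg (Suc n) x + real n * leg (n - 1) x"
proof (cases n)
  case 0
  then show ?thesis by (simp add: legendre_0 legendre_1)
next
  case (Suc m)
  have a: "leg' (Suc m) x = real (Suc m) * leg m x + x * leg' m x"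
    by (rule legendre_pderiv_Suc)
  have b: "real (Suc m) * leg (Suc m) x = real (Suc m) * x * leg m x + (x\<^sup>2 - 1) * leg' m x"
    by (rule legendre_Suc)
  have c: "real (Suc n) * leg (Suc n) x = real (Suc n) * x * leg n x + (x\<^sup>2 - 1) * leg' n x"
    by (rule legendre_Suc)
  have "(x\<^sup>2 - 1) * leg' (Suc m) x = (x\<^sup>2 - 1) * (real (Suc m) * leg m x) + x * ((x\<^sup>2 - 1) * leg' m x)"
    unfolding a by (simp add: algebra_simps)
  also have "(x\<^sup>2 - 1) * leg' m x = real (Suc m) * leg (Suc m) x - real (Suc m) * x * leg m x"
    using b by simp
  finally have "(x\<^sup>2 - 1) * leg' (Suc m) x = real (Suc m) * (x * leg (Suc m) x - leg m x)"
    by (simp add: algebra_simps power2_eq_square)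
  then show ?thesis
    using c unfolding Suc by (simp add: algebra_simps)
qed

text \<open>Eliminating \<open>x * leg' (Suc n) x\<close> leaves a recurrence in steps of two with
  explicit increments, from which the growth of the derivatives is read off.\<close>

lemma legendre_pderiv_diff: "leg' (Suc (Suc n)) x - leg' n x = real (2 * n + 3) * leg (Suc n) x"
proof -
  have "x * leg' (Suc n) x = real (Suc n) * x * leg n x + (x\<^sup>2 - 1) * leg' n x + leg' n x"
    unfolding legendre_pderiv_Suc[of n] by (simp add: algebra_simps power2_eq_square)
  also have "\<dots> = real (Suc n) * leg (Suc n) x + leg' n x"
    unfolding legendre_Suc ..
  finally show ?thesis
    unfolding legendre_pderiv_Suc[of "Suc n"] by (simp add: algebra_simps)
qed

text \<open>By \<open>legendre_Suc\<close> the function to be differentiated is a combination of two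
  Legendre polynomials, so no second derivative enters. The self-adjoint form serves both Sonin's
  function and orthogonality.\<close>

lemma legendre_ODE:
  "((\<lambda>x. (x\<^sup>2 - 1) * leg' n x) has_real_derivative real (n * Suc n) * leg n x) (at x)"
proof -
  have "((\<lambda>x. real (Suc n) * leg (Suc n) x - real (Suc n) * (x * leg n x)) has_real_derivative
      real (Suc n) * leg' (Suc n) x - real (Suc n) * (x * leg' n x + leg n x)) (at x)"
    by (auto intro!: derivative_eq_intros poly_DERIV)
  moreover have "(\<lambda>x. real (Suc n) * leg (Suc n) x - real (Suc n) * (x * leg n x)) = (\<lambda>x. (x\<^sup>2 - 1) * leg' n x)"
    using legendre_Suc[of n] by (auto simp: fun_eq_iff algebra_simps)
  moreover have "real (Suc n) * leg' (Suc n) x - real (Suc n) * (x * leg' n x + leg n x) = real (n * Suc n) * leg n x"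
    unfolding legendre_pderiv_Suc by (simp add: algebra_simps)
  ultimately show ?thesis by metis
qed

section \<open>Endpoint values and pointwise bounds on [-1, 1]\<close>

lemma legendre_at_1: "leg n 1 = 1"
proof (induction n)
  case (Suc n)
  then show ?case using legendre_Suc[of n 1] by simp
qed simp

lemma legendre_at_minus_1: "leg n (-1) = (-1) ^ n"
proof (induction n)
  case (Suc n)
  then have "real (Suc n) * leg (Suc n) (-1) = real (Suc n) * (-1) ^ Suc n"
    using legendre_Suc[of n "-1"] by (simp add: algebra_simps)
  then show ?case by (simp only: mult_cancel_left) simp
qed simp

text \<open>Sonin's function \<open>n (n + 1) P\<^sub>n\<^sup>2 + (1 - u\<^sup>2) P\<^sub>n'\<^sup>2\<close> has derivative \<open>2 u P\<^sub>n'\<^sup>2\<close>,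
  so it is largest at the endpoints.\<close>

lemma abs_legendre_le_1:
  assumes "x \<in> {-1..1}"
  shows "\<bar>leg n x\<bar> \<le> 1"
proof (cases "n = 0")
  case False
  define c where "c = real (n * Suc n)"
  have c: "c > 0" using False by (simp add: c_def add_pos_nonneg)
  define F where "F = (\<lambda>x. c * (leg n x)\<^sup>2 - ((x\<^sup>2 - 1) * leg' n x) * leg' n x)"
  have dd: "(x\<^sup>2 - 1) * poly (pderiv (pderiv (legendre n))) x = c * leg n x - 2 * x * leg' n x" for x
  proof -
    have "((\<lambda>x. (x\<^sup>2 - 1) * leg' n x) has_real_derivative
        ((x\<^sup>2 - 1) * poly (pderiv (pderiv (legendre n))) x + 2 * x * leg' n x)) (at x)"
      by (auto intro!: derivative_eq_intros poly_DERIV)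
    from DERIV_unique[OF this legendre_ODE] show ?thesis by (simp add: c_def)
  qed
  have dF: "(F has_real_derivative 2 * x * (leg' n x)\<^sup>2) (at x)" for x
  proof -
    have "(F has_real_derivative c * (2 * leg n x * leg' n x) -
        (c * leg n x * leg' n x + ((x\<^sup>2 - 1) * leg' n x) * poly (pderiv (pderiv (legendre n))) x)) (at x)"
      unfolding F_def c_def
      by (rule derivative_eq_intros legendre_ODE poly_DERIV refl)+ (simp add: algebra_simps)
    moreover have "c * (2 * leg n x * leg' n x) -
        (c * leg n x * leg' n x + ((x\<^sup>2 - 1) * leg' n x) * poly (pderiv (pderiv (legendre n))) x) =
        2 * x * (leg' n x)\<^sup>2"
      using arg_cong[OF dd[of x], of "\<lambda>y. y * leg' n x"] by (simp add: algebra_simps power2_eq_square)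
    ultimately show ?thesis by simp
  qed
  have "F x \<le> c"
  proof (cases "x \<ge> 0")
    case True
    have "F x \<le> F 1"
      by (rule DERIV_nonneg_imp_nondecreasing) (use assms True in \<open>auto intro!: exI dF\<close>)
    then show ?thesis by (simp add: F_def legendre_at_1)
  next
    case False
    have "F x \<le> F (-1)"
      by (rule DERIV_nonpos_imp_nonincreasing)
        (use assms False in \<open>auto intro!: exI dF simp: mult_le_0_iff\<close>)
    then show ?thesis by (simp add: F_def legendre_at_minus_1 flip: power_mult)
  qed
  moreover have "(x\<^sup>2 - 1) * leg' n x * leg' n x \<le> 0"
  proof -
    have "x\<^sup>2 \<le> 1" using assms by (auto simp: abs_square_le_1)
    then have "(x\<^sup>2 - 1) * (leg' n x)\<^sup>2 \<le> 0" by (intro mult_nonpos_nonneg) auto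
    then show ?thesis by (simp add: power2_eq_square)
  qed
  ultimately have "c * (leg n x)\<^sup>2 \<le> c" unfolding F_def by linarith
  then have "(leg n x)\<^sup>2 \<le> 1" using c by simp
  then show ?thesis by (simp add: abs_square_le_1)
qed simp

text \<open>Induction in steps of two along \<open>legendre_pderiv_diff\<close>. The sharp bound is
  \<open>n (n + 1) / 2\<close>, the value at 1; the cruder square is convenient because a factor
  \<open>(l + 1/2)^2\<close> turns the weight of index \<open>s\<close> into that of index
  \<open>s + 1\<close>.\<close>

lemma abs_legendre_pderiv_le:
  assumes "x \<in> {-1..1}"
  shows "\<bar>leg' n x\<bar> \<le> (real n + 1/2)\<^sup>2"
proof (induction n rule: induct_nat_012)
  case (ge2 n)
  have "leg' (Suc (Suc n)) x = leg' n x + real (2 * n + 3) * leg (Suc n) x"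
    using legendre_pderiv_diff[of n x] by simp
  then have "\<bar>leg' (Suc (Suc n)) x\<bar> \<le> \<bar>leg' n x\<bar> + real (2 * n + 3) * \<bar>leg (Suc n) x\<bar>"
    by (metis abs_mult abs_of_nat abs_triangle_ineq)
  also have "\<dots> \<le> (real n + 1/2)\<^sup>2 + real (2 * n + 3) * 1"
    by (intro add_mono ge2 mult_left_mono abs_legendre_le_1 assms) auto
  also have "\<dots> \<le> (real (Suc (Suc n)) + 1/2)\<^sup>2"
    by (simp add: power2_eq_square algebra_simps)
  finally show ?case .
qed (auto simp: legendre_0 legendre_1 pderiv_pCons power2_eq_square)

text \<open>Mean value theorem between \<open>x\<close> and 1, where every Legendre polynomial takes
  the value 1.\<close>

lemma legendre_ge:
  assumes "x \<in> {-1..1}"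
  shows "leg n x \<ge> 1 - (real n + 1/2)\<^sup>2 * (1 - x)"
proof (cases "x = 1")
  case False
  then have x: "x < 1" using assms by simp
  obtain y where y: "x < y" "y < 1" "leg n 1 - leg n x = (1 - x) * leg' n y"
    using MVT2[OF x poly_DERIV, of "legendre n"] by auto
  have "leg' n y \<le> (real n + 1/2)\<^sup>2"
    using abs_legendre_pderiv_le[of y n] y assms by auto
  then have "(1 - x) * leg' n y \<le> (1 - x) * (real n + 1/2)\<^sup>2"
    using x by (intro mult_left_mono) auto
  then show ?thesis using y(3) by (simp add: legendre_at_1 algebra_simps)
qed (simp add: legendre_at_1)

section \<open>Legendre series\<close>

text \<open>Orthogonality is self-adjointness of the Legendre operator: \<open>?W\<close> is the
  boundary term and vanishes at both ends. The norms come from evaluating the integral of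
  \<open>x * leg n x * leg (Suc n) x\<close> twice, applying the recurrence to one factor and then
  to the other.\<close>

lemma integral_legendre_mult:
  "integral {-1..1} (\<lambda>x. leg m x * leg n x) = (if m = n then 1 / (real n + 1/2) else 0)"
proof -
  have int2: "(\<lambda>x. leg m x * leg n x) integrable_on {-1..1}" for m n
    by (intro integrable_continuous_real continuous_intros)
  have orth: "integral {-1..1} (\<lambda>x. leg m x * leg n x) = 0" if "m \<noteq> n" for m n
  proof -
    let ?W = "\<lambda>x. (x\<^sup>2 - 1) * leg' m x * leg n x - (x\<^sup>2 - 1) * leg' n x * leg m x"
    let ?c = "real (m * Suc m) - real (n * Suc n)"
    have "(?W has_real_derivative ?c * (leg m x * leg n x)) (at x)" for x
      by (rule derivative_eq_intros legendre_ODE poly_DERIV refl)+ (simp add: algebra_simps)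
    then have "((\<lambda>x. ?c * (leg m x * leg n x)) has_integral ?W 1 - ?W (-1)) {-1..1}"
      by (intro fundamental_theorem_of_calculus)
        (auto simp: has_real_derivative_iff_has_vector_derivative[symmetric]
              intro: has_field_derivative_at_within)
    moreover have "?W 1 - ?W (-1) = 0"
      by simp
    ultimately have "integral {-1..1} (\<lambda>x. ?c * (leg m x * leg n x)) = 0"
      by (metis integral_unique)
    then have "?c * integral {-1..1} (\<lambda>x. leg m x * leg n x) = 0"
      by simp
    moreover have "?c \<noteq> 0"
    proof
      assume "?c = 0"
      then have "real (m * Suc m) = real (n * Suc n)" by linarith
      then have "m * Suc m = n * Suc n" by (simp only: of_nat_eq_iff)
      moreover have "m * Suc m < n * Suc n" if "m < n" for m n :: nat
        using that by (intro mult_strict_mono) auto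
      ultimately show False using that by (metis nat_neq_iff)
    qed
    ultimately show ?thesis by simp
  qed
  have norm: "integral {-1..1} (\<lambda>x. leg n x * leg n x) = 1 / (real n + 1/2)" for n
  proof (induction n)
    case 0
    show ?case by simp
  next
    case (Suc n)
    have "real (2 * n + 1) * integral {-1..1} (\<lambda>x. x * leg n x * leg (Suc n) x) =
        integral {-1..1} (\<lambda>x. real (Suc n) * (leg (Suc n) x * leg (Suc n) x) + real n * (leg (n - 1) x * leg (Suc n) x))"
      unfolding integral_mult_right[symmetric]
      by (intro integral_cong) (use legendre_recurrence[of n] in \<open>metis (no_types, lifting) distrib_right mult.assoc\<close>)
    also have "\<dots> = real (Suc n) * integral {-1..1} (\<lambda>x. leg (Suc n) x * leg (Suc n) x)"
      by (subst integral_add) (auto intro!: integrable_on_mult_right int2 simp: orth)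
    finally have 1: "real (2 * n + 1) * integral {-1..1} (\<lambda>x. x * leg n x * leg (Suc n) x) = \<dots>" .
    have "real (2 * Suc n + 1) * integral {-1..1} (\<lambda>x. x * leg (Suc n) x * leg n x) =
        integral {-1..1} (\<lambda>x. real (Suc (Suc n)) * (leg (Suc (Suc n)) x * leg n x) + real (Suc n) * (leg n x * leg n x))"
      unfolding integral_mult_right[symmetric]
      by (intro integral_cong) (use legendre_recurrence[of "Suc n"] in \<open>metis (no_types, lifting) distrib_right mult.assoc diff_Suc_1\<close>)
    also have "\<dots> = real (Suc n) * integral {-1..1} (\<lambda>x. leg n x * leg n x)"
      by (subst integral_add) (auto intro!: integrable_on_mult_right int2 simp: orth)
    finally have 2: "real (2 * Suc n + 1) * integral {-1..1} (\<lambda>x. x * leg (Suc n) x * leg n x) = real (Suc n) / (real n + 1/2)"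
      unfolding Suc.IH by simp
    have "(\<lambda>x. x * leg (Suc n) x * leg n x) = (\<lambda>x. x * leg n x * leg (Suc n) x)"
      by (simp add: fun_eq_iff)
    note 2 = 2[unfolded this]
    have 3: "integral {-1..1} (\<lambda>x. x * leg n x * leg (Suc n) x) = real (Suc n) / (real n + 1/2) / real (2 * Suc n + 1)"
      by (subst nonzero_eq_divide_eq) (simp, metis 2 mult.commute)
    have "integral {-1..1} (\<lambda>x. leg (Suc n) x * leg (Suc n) x) =
       real (2 * n + 1) * (real (Suc n) / (real n + 1/2) / real (2 * Suc n + 1)) / real (Suc n)"
      by (subst nonzero_eq_divide_eq) (simp, metis 1 3 mult.commute)
    also have "\<dots> = 1 / (real (Suc n) + 1/2)"
    proof -
      have "2 * q * (S / q / (2 * r)) / S = 1 / r" if "q > 0" "S > 0" for q r S :: real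
        using that by simp
      moreover have "real (2 * n + 1) = 2 * (real n + 1/2)" "real (2 * Suc n + 1) = 2 * (real (Suc n) + 1/2)"
        by simp_all
      ultimately show ?thesis
        by (simp only:)
    qed
    finally show ?case .
  qed
  show ?thesis using orth norm by auto
qed

section \<open>Uniformly convergent Legendre series\<close>

lemma legendre_series_uniform_limit:
  assumes "summable (\<lambda>l. \<bar>d l\<bar>)"
  shows "uniform_limit {-1..1} (\<lambda>n x. \<Sum>l<n. d l * leg l x) (\<lambda>x. \<Sum>l. d l * leg l x) sequentially"
proof (rule Weierstrass_m_test[OF _ assms])
  fix n x assume "x \<in> {-1..1 :: real}"
  then show "norm (d n * leg n x) \<le> \<bar>d n\<bar>"
    using abs_legendre_le_1[of x n] by (simp add: abs_mult mult_left_le)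
qed

lemma continuous_on_legendre_series:
  assumes "summable (\<lambda>l. \<bar>d l\<bar>)"
  shows "continuous_on {-1..1} (\<lambda>x. \<Sum>l. d l * leg l x)"
  by (rule uniform_limit_theorem[OF _ legendre_series_uniform_limit[OF assms]])
    (auto intro!: always_eventually continuous_intros)

text \<open>Parseval as an inequality: orthogonality evaluates the integral for partial sums, and
  uniform convergence carries the bound to the limit.\<close>

lemma integral_legendre_series_sq_le:
  assumes "summable (\<lambda>l. \<bar>d l\<bar>)"
    and M: "\<And>n. (\<Sum>l<n. (d l)\<^sup>2 / (real l + 1/2)) \<le> M"
  shows "integral {-1..1} (\<lambda>x. (\<Sum>l. d l * leg l x)\<^sup>2) \<le> M"
proof -
  let ?S = "\<lambda>n x. \<Sum>l<n. d l * leg l x" and ?G = "\<lambda>x. \<Sum>l. d l * leg l x"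
  note u = legendre_series_uniform_limit[OF assms(1)]
  have bd: "bounded (f ` {-1..1})" if "continuous_on {-1..1} f" for f :: "real \<Rightarrow> real"
    by (intro compact_imp_bounded compact_continuous_image that) auto
  have unif: "uniform_limit {-1..1} (\<lambda>n x. ?S n x * ?S n x) (\<lambda>x. ?G x * ?G x) sequentially"
    by (intro uniform_lim_mult u bd continuous_on_legendre_series assms)
  have c: "continuous_on {-1..1} (\<lambda>x. ?S n x * ?S n x)" for n
    by (intro continuous_intros)
  obtain I J where IJ: "\<And>n. ((\<lambda>x. ?S n x * ?S n x) has_integral I n) {-1..1}"
    "((\<lambda>x. ?G x * ?G x) has_integral J) {-1..1}" "I \<longlonglongrightarrow> J"
    by (rule uniform_limit_integral[OF unif c]) auto
  have "I n = (\<Sum>l<n. (d l)\<^sup>2 / (real l + 1/2))" for n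
  proof -
    have "I n = integral {-1..1} (\<lambda>x. \<Sum>l<n. \<Sum>m<n. d l * d m * (leg l x * leg m x))"
      using IJ(1)[of n] by (simp add: integral_unique[symmetric] sum_product mult_ac)
    also have "\<dots> = (\<Sum>l<n. \<Sum>m<n. d l * d m * integral {-1..1} (\<lambda>x. leg l x * leg m x))"
      by (subst integral_sum, simp, intro integrable_continuous_real continuous_intros)
        (intro sum.cong refl, subst integral_sum, auto intro!: integrable_continuous_real continuous_intros)
    also have "\<dots> = (\<Sum>l<n. (d l)\<^sup>2 / (real l + 1/2))"
      unfolding integral_legendre_mult by (intro sum.cong refl) (simp add: if_distrib sum.delta' power2_eq_square cong: if_cong)
    finally show ?thesis .
  qed
  then have "J \<le> M"
    using M by (intro LIMSEQ_le_const2[OF IJ(3)]) auto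
  then show ?thesis
    using IJ(2) by (simp add: integral_unique power2_eq_square)
qed

text \<open>Summation by parts against the three-term recurrence: multiplication by \<open>1 - u\<close> acts on the
  coefficients as a second difference, which gains a factor \<open>R\<^sup>-\<^sup>2\<close> for coefficients
  varying at scale \<open>R\<close>.\<close>

lemma legendre_series_mult_one_minus:
  fixes a :: "nat \<Rightarrow> real"
  defines "d \<equiv> \<lambda>l. (real l * (a l - a (l - 1)) - real (Suc l) * (a (Suc l) - a l)) / 2"
  assumes sa: "summable (\<lambda>l. \<bar>a l\<bar> * (real l + 1/2))" and x: "x \<in> {-1..1}"
  shows "(1 - x) * (\<Sum>l. a l * (real l + 1/2) * leg l x) = (\<Sum>l. d l * leg l x)"
proof -
  have *: "summable (\<lambda>l. c l * leg (g l) x)" if "\<And>l. \<bar>c l\<bar> \<le> 2 * (\<bar>a l\<bar> * (real l + 1/2))" for c g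
  proof (rule summable_comparison_test')
    show "summable (\<lambda>l. 2 * (\<bar>a l\<bar> * (real l + 1/2)))"
      using sa by (rule summable_mult)
    show "norm (c l * leg (g l) x) \<le> 2 * (\<bar>a l\<bar> * (real l + 1/2))" for l
      using mult_mono[OF that[of l] abs_legendre_le_1[OF x, of "g l"]] by (simp add: abs_mult)
  qed
  have bds: "\<bar>a l * real (Suc l)\<bar> \<le> 2 * (\<bar>a l\<bar> * (real l + 1/2))"
    "\<bar>a l * real l\<bar> \<le> 2 * (\<bar>a l\<bar> * (real l + 1/2))"
    "\<bar>a l * (real l + 1/2)\<bar> \<le> 2 * (\<bar>a l\<bar> * (real l + 1/2))" for l
    unfolding abs_mult by (auto simp: algebra_simps abs_of_nonneg)
  obtain A where A: "(\<lambda>l. a l * real (Suc l) * leg (Suc l) x) sums A"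
    using *[OF bds(1), of Suc] by (auto simp: summable_def)
  obtain C where C: "(\<lambda>l. a l * real l * leg (l - 1) x) sums C"
    using *[OF bds(2), of "\<lambda>l. l - 1"] by (auto simp: summable_def)
  obtain D where D: "(\<lambda>l. a l * (real l + 1/2) * leg l x) sums D"
    using *[OF bds(3), of "\<lambda>l. l"] by (auto simp: summable_def)
  \<comment> \<open>The index shifts create no boundary terms: at index 0 the factor
    \<open>real l\<close> vanishes, which also makes the truncated \<open>l - 1\<close>
    irrelevant.\<close>
  have A': "(\<lambda>l. a (l - 1) * real l * leg l x) sums A"
    using A sums_Suc_iff[of "\<lambda>l. a (l - 1) * real l * leg l x" A] by simp
  have C': "(\<lambda>l. a (Suc l) * real (Suc l) * leg l x) sums C"
    using C sums_Suc_iff[of "\<lambda>l. a l * real l * leg (l - 1) x" C] by simp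
  have step: "x * (a l * (real l + 1/2) * leg l x) =
      (a l * real (Suc l) * leg (Suc l) x + a l * real l * leg (l - 1) x) / 2" for l
    using arg_cong[OF legendre_recurrence[of l x], of "\<lambda>y. a l * y / 2"] by (simp add: algebra_simps)
  have "(\<lambda>l. x * (a l * (real l + 1/2) * leg l x)) sums ((A + C) / 2)"
    unfolding step by (intro sums_divide sums_add A C)
  from sums_unique2[OF this sums_mult[OF D]] have xD: "x * D = (A + C) / 2" by simp
  have "(\<lambda>l. a l * (real l + 1/2) * leg l x - (a (l - 1) * real l * leg l x + a (Suc l) * real (Suc l) * leg l x) / 2)
      sums (D - (A + C) / 2)"
    by (intro sums_diff sums_divide sums_add A' C' D)
  also have "(\<lambda>l. a l * (real l + 1/2) * leg l x - (a (l - 1) * real l * leg l x + a (Suc l) * real (Suc l) * leg l x) / 2)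
     = (\<lambda>l. d l * leg l x)"
    by (simp add: d_def fun_eq_iff field_simps)
  finally have "(\<Sum>l. d l * leg l x) = D - (A + C) / 2"
    by (simp add: sums_iff)
  moreover have "(\<Sum>l. a l * (real l + 1/2) * leg l x) = D"
    using D by (simp only: sums_iff)
  ultimately show ?thesis by (simp add: xD[symmetric] left_diff_distrib)
qed

section \<open>Decay of the weight function\<close>

text \<open>An integral test by telescoping: up to a factor the summand is a difference of
  \<open>h\<close>, mirroring the antiderivative of \<open>t / (1 + t^2)^2\<close>. The half-integer
  makes the numerator exact, as \<open>(l + 1)^2 - l^2 = 2 (l + 1/2)\<close>.\<close>

lemma sum_reciprocal_square_le:
  assumes "R > 0"
  shows "(\<Sum>l<n. (real l + 1/2) / (1 + ((real l + 1/2) / R)\<^sup>2)\<^sup>2) \<le> 2 * R\<^sup>2"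
proof -
  define h where "h = (\<lambda>l. R\<^sup>2 / (1 + (real l / R)\<^sup>2))"
  have pos: "1 + y\<^sup>2 > 0" for y :: real
    using zero_le_power2[of y] by linarith
  have le: "(real l + 1/2) / (1 + ((real l + 1/2) / R)\<^sup>2)\<^sup>2 \<le> 2 * (h l - h (Suc l))" for l
  proof -
    define A B X where "A = 1 + (real l / R)\<^sup>2" and "B = 1 + (real (Suc l) / R)\<^sup>2"
      and "X = 1 + ((real l + 1/2) / R)\<^sup>2"
    have p: "A > 0" "B > 0" "X > 0" by (simp_all add: A_def B_def X_def pos)
    have "A \<le> X"
      unfolding A_def X_def using assms by (intro add_left_mono power_mono divide_right_mono) auto
    \<comment> \<open>Since \<open>l + 1\<close> is at most twice \<open>l + 1/2\<close>. With the
      bound on \<open>A\<close> this costs a factor 4 in \<open>A * B\<close>, hence the 2 in front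
      of the telescoping sum.\<close>
    moreover have "B \<le> 4 * X"
    proof -
      define y where "y = (real l + 1/2) / R"
      have "(real (Suc l) / R)\<^sup>2 \<le> (2 * y)\<^sup>2"
        unfolding y_def using assms by (intro power_mono) (auto simp: field_simps)
      also have "\<dots> = 4 * y\<^sup>2"
        by (simp add: power_mult_distrib)
      finally have "1 + (real (Suc l) / R)\<^sup>2 \<le> 4 * (1 + y\<^sup>2)"
        by argo
      then show ?thesis unfolding B_def X_def y_def .
    qed
    ultimately have "A * B \<le> X * (4 * X)"
      using p by (intro mult_mono) auto
    then have AB: "A * B \<le> 4 * X\<^sup>2" by (simp add: power2_eq_square)
    have "h l - h (Suc l) = R\<^sup>2 * (B - A) / (A * B)"
      unfolding h_def A_def[symmetric] B_def[symmetric] using p by (simp add: field_simps)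
    also have "R\<^sup>2 * (B - A) = 2 * (real l + 1/2)"
      unfolding A_def B_def using assms by (simp add: field_simps power2_eq_square)
    finally have eq: "2 * (h l - h (Suc l)) = 4 * (real l + 1/2) / (A * B)" by simp
    have "(real l + 1/2) / X\<^sup>2 = 4 * (real l + 1/2) / (4 * X\<^sup>2)"
      by (subst mult_divide_mult_cancel_left) simp_all
    also have "\<dots> \<le> 4 * (real l + 1/2) / (A * B)"
      using p AB by (intro divide_left_mono) auto
    finally show ?thesis unfolding eq X_def .
  qed
  have "(\<Sum>l<n. (real l + 1/2) / (1 + ((real l + 1/2) / R)\<^sup>2)\<^sup>2) \<le> (\<Sum>l<n. 2 * (h l - h (Suc l)))"
    by (intro sum_mono le)
  also have "\<dots> = 2 * (h 0 - h n)"
    by (simp only: sum_distrib_left[symmetric] sum_lessThan_telescope')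
  also have "\<dots> \<le> 2 * R\<^sup>2"
    using pos[of "real n / R"] by (simp add: h_def divide_nonneg_pos)
  finally show ?thesis .
qed

lemma summable_reciprocal_square:
  assumes "R > 0"
  shows "summable (\<lambda>l. (real l + 1/2) / (1 + ((real l + 1/2) / R)\<^sup>2)\<^sup>2)"
  by (rule summableI_nonneg_bounded[OF _ sum_reciprocal_square_le[OF assms]]) simp

section \<open>Gaussian decay of the weight and of its derivatives\<close>

lemma gaussian_moment_le: "t ^ (2 * m) * exp (- (t\<^sup>2)) \<le> (fact m :: real)"
proof -
  have "(t\<^sup>2) ^ m / fact m \<le> exp (t\<^sup>2)"
    using sum_le_suminf[of "\<lambda>n. (t\<^sup>2) ^ n /\<^sub>R fact n" "{m}"] summable_exp_generic[of "t\<^sup>2"]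
    by (auto simp: exp_def divide_inverse mult.commute)
  then have "(t\<^sup>2) ^ m \<le> fact m * exp (t\<^sup>2)"
    by (simp add: field_simps)
  then have "(t\<^sup>2) ^ m / exp (t\<^sup>2) \<le> fact m"
    by (subst pos_divide_le_eq) simp_all
  then show ?thesis
    unfolding power_mult exp_minus divide_inverse .
qed

text \<open>Expanding \<open>(1 + t^2)^2\<close> turns the claim into bounds for three Gaussian
  moments, each at most a factorial.\<close>

lemma gaussian_moment_decay:
  obtains D :: real where "D > 0" "\<And>t. t ^ (2 * m) * exp (- (t\<^sup>2)) \<le> D / (1 + t\<^sup>2)\<^sup>2"
proof
  let ?D = "fact m + 2 * fact (Suc m) + fact (Suc (Suc m)) :: real"
  show "?D > 0" by (intro add_pos_pos) auto
  fix t :: real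
  have p: "(1 + t\<^sup>2)\<^sup>2 > 0" using zero_le_power2[of t] by (intro zero_less_power) linarith
  have "t ^ (2 * m) * exp (- (t\<^sup>2)) * (1 + t\<^sup>2)\<^sup>2 =
      t ^ (2 * m) * exp (- (t\<^sup>2)) + 2 * (t ^ (2 * Suc m) * exp (- (t\<^sup>2))) + t ^ (2 * Suc (Suc m)) * exp (- (t\<^sup>2))"
    by (simp add: power2_eq_square algebra_simps)
  also have "\<dots> \<le> ?D"
    by (intro add_mono mult_left_mono gaussian_moment_le) auto
  finally show "t ^ (2 * m) * exp (- (t\<^sup>2)) \<le> ?D / (1 + t\<^sup>2)\<^sup>2"
    using p by (simp add: pos_le_divide_eq)
qed

text \<open>For \<open>s\<close> at least 1, the first derivative of the weight. The factor
  \<open>t\<close> is split off so that the vanishing at the origin stays visible and only even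
  moments remain to be estimated.\<close>

definition mexican_weight' :: "nat \<Rightarrow> real \<Rightarrow> real" where
  "mexican_weight' s t = t * ((2 * real s * t ^ (2 * (s - 1)) - 2 * t ^ (2 * s)) * exp (- (t\<^sup>2)))"

definition mexican_weight'' :: "nat \<Rightarrow> real \<Rightarrow> real" where
  "mexican_weight'' s t = (2 * real s * (2 * real s - 1) * t ^ (2 * (s - 1))
     - (8 * real s + 2) * t ^ (2 * s) + 4 * t ^ (2 * Suc s)) * exp (- (t\<^sup>2))"

lemma mexican_weight_deriv:
  assumes "s \<ge> 1"
  shows "(mexican_weight s has_real_derivative mexican_weight' s t) (at t)"
proof -
  obtain r where r: "s = Suc r" using assms by (cases s) auto
  have "((\<lambda>t. t ^ (2 * s) * exp (- (t\<^sup>2))) has_real_derivative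
      real (2 * s) * t ^ (2 * s - 1) * exp (- (t\<^sup>2)) + t ^ (2 * s) * (exp (- (t\<^sup>2)) * (- (2 * t)))) (at t)"
    by (auto intro!: derivative_eq_intros)
  also have "real (2 * s) * t ^ (2 * s - 1) * exp (- (t\<^sup>2)) + t ^ (2 * s) * (exp (- (t\<^sup>2)) * (- (2 * t))) = mexican_weight' s t"
    by (simp add: mexican_weight'_def r algebra_simps)
  finally show ?thesis by (simp add: mexican_weight_def[abs_def])
qed

lemma mexican_weight'_deriv:
  assumes "s \<ge> 1"
  shows "(mexican_weight' s has_real_derivative mexican_weight'' s t) (at t)"
proof -
  obtain r where r: "s = Suc r" using assms by (cases s) auto
  have eq: "mexican_weight' s = (\<lambda>t. (2 * real s * t ^ Suc (2 * r) - 2 * t ^ Suc (Suc (Suc (2 * r)))) * exp (- (t\<^sup>2)))"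
    by (simp add: mexican_weight'_def r algebra_simps fun_eq_iff)
  show ?thesis unfolding eq
    by (rule derivative_eq_intros refl)+ (simp add: mexican_weight''_def r algebra_simps)
qed

text \<open>All three functions are built from the same three consecutive even moments, so
  \<open>comb\<close> provides a common constant. The factor \<open>\<bar>t\<bar>\<close> in the
  bound for the first derivative is kept because it later supplies a power of
  \<open>1 / R\<close>.\<close>

lemma mexican_weight_bounds:
  assumes "s \<ge> 1"
  obtains D where "D > 0"
    "\<And>t. 0 \<le> mexican_weight s t" "\<And>t. mexican_weight s t \<le> D / (1 + t\<^sup>2)\<^sup>2"
    "\<And>t. \<bar>mexican_weight' s t\<bar> \<le> \<bar>t\<bar> * (D / (1 + t\<^sup>2)\<^sup>2)"
    "\<And>t. \<bar>mexican_weight'' s t\<bar> \<le> D / (1 + t\<^sup>2)\<^sup>2"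
proof -
  obtain D0 where D0: "D0 > 0" "\<And>t :: real. t ^ (2 * (s - 1)) * exp (- (t\<^sup>2)) \<le> D0 / (1 + t\<^sup>2)\<^sup>2"
    using gaussian_moment_decay[of "s - 1"] by blast
  obtain D1 where D1: "D1 > 0" "\<And>t :: real. t ^ (2 * s) * exp (- (t\<^sup>2)) \<le> D1 / (1 + t\<^sup>2)\<^sup>2"
    using gaussian_moment_decay[of s] by blast
  obtain D2 where D2: "D2 > 0" "\<And>t :: real. t ^ (2 * Suc s) * exp (- (t\<^sup>2)) \<le> D2 / (1 + t\<^sup>2)\<^sup>2"
    using gaussian_moment_decay[of "Suc s"] by blast
  define D where "D = 2 * real s * (2 * real s + 1) * D0 + (8 * real s + 2) * D1 + 4 * D2"
  have comb: "a * x0 + b * x1 + c * x2 \<le> D / Q"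
    if "x0 \<le> D0 / Q" "x1 \<le> D1 / Q" "x2 \<le> D2 / Q" "Q > 0"
       "0 \<le> a" "a \<le> 2 * real s * (2 * real s + 1)" "0 \<le> b" "b \<le> 8 * real s + 2" "0 \<le> c" "c \<le> 4"
    for a b c x0 x1 x2 Q
  proof -
    have "a * x0 \<le> (2 * real s * (2 * real s + 1)) * (D0 / Q)"
      using that D0(1) by (intro order_trans[OF mult_left_mono mult_right_mono]) auto
    moreover have "b * x1 \<le> (8 * real s + 2) * (D1 / Q)"
      using that D1(1) by (intro order_trans[OF mult_left_mono mult_right_mono]) auto
    moreover have "c * x2 \<le> 4 * (D2 / Q)"
      using that D2(1) by (intro order_trans[OF mult_left_mono mult_right_mono]) auto
    ultimately show ?thesis unfolding D_def by (simp add: add_divide_distrib)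
  qed
  have Q: "(1 + t\<^sup>2)\<^sup>2 > 0" for t :: real
    using zero_le_power2[of t] by (intro zero_less_power) linarith
  have nn: "t ^ (2 * m) * exp (- (t\<^sup>2)) \<ge> 0" for t :: real and m
    by (simp add: power_mult)
  note b = comb[OF D0(2) D1(2) D2(2) Q]
  show ?thesis
  proof (rule that)
    show "D > 0" using D0(1) D1(1) D2(1) unfolding D_def
      by (intro add_nonneg_pos add_nonneg_nonneg mult_nonneg_nonneg) auto
    show "0 \<le> mexican_weight s t" for t
      using nn[of t s] by (simp add: mexican_weight_def)
    show "mexican_weight s t \<le> D / (1 + t\<^sup>2)\<^sup>2" for t
      using b[of 0 1 0 t] by (simp add: mexican_weight_def)
    show "\<bar>mexican_weight' s t\<bar> \<le> \<bar>t\<bar> * (D / (1 + t\<^sup>2)\<^sup>2)" for t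
    proof -
      have "\<bar>(2 * real s * t ^ (2 * (s - 1)) - 2 * t ^ (2 * s)) * exp (- (t\<^sup>2))\<bar> \<le>
        2 * real s * (t ^ (2 * (s - 1)) * exp (- (t\<^sup>2))) + 2 * (t ^ (2 * s) * exp (- (t\<^sup>2)))"
        using mult_nonneg_nonneg[of "2 * real s", OF _ nn[of t "s - 1"]] nn[of t s]
        by (simp add: abs_le_iff algebra_simps)
      also have "\<dots> \<le> D / (1 + t\<^sup>2)\<^sup>2"
        using b[of "2 * real s" 2 0 t] mult_left_mono[of 1 "2 * real s + 1" "real s"] by simp
      finally show ?thesis
        unfolding mexican_weight'_def abs_mult[of t] by (intro mult_left_mono) auto
    qed
    show "\<bar>mexican_weight'' s t\<bar> \<le> D / (1 + t\<^sup>2)\<^sup>2" for t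
    proof -
      have "\<bar>mexican_weight'' s t\<bar> \<le> 2 * real s * (2 * real s - 1) * (t ^ (2 * (s - 1)) * exp (- (t\<^sup>2)))
         + (8 * real s + 2) * (t ^ (2 * s) * exp (- (t\<^sup>2))) + 4 * (t ^ (2 * Suc s) * exp (- (t\<^sup>2)))"
      proof -
        define x0 x1 x2 where "x0 = t ^ (2 * (s - 1)) * exp (- (t\<^sup>2))"
          and "x1 = t ^ (2 * s) * exp (- (t\<^sup>2))" and "x2 = t ^ (2 * Suc s) * exp (- (t\<^sup>2))"
        have "mexican_weight'' s t = 2 * real s * (2 * real s - 1) * x0 - (8 * real s + 2) * x1 + 4 * x2"
          unfolding mexican_weight''_def x0_def x1_def x2_def by (simp add: algebra_simps)
        moreover have "2 * real s * (2 * real s - 1) * x0 \<ge> 0" "(8 * real s + 2) * x1 \<ge> 0" "4 * x2 \<ge> 0"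
          using assms unfolding x0_def x1_def x2_def by (intro mult_nonneg_nonneg nn; simp)+
        ultimately show ?thesis
          unfolding x0_def[symmetric] x1_def[symmetric] x2_def[symmetric] by linarith
      qed
      also have "\<dots> \<le> D / (1 + t\<^sup>2)\<^sup>2"
        using assms by (intro b) (auto simp: mult_left_mono)
      finally show ?thesis .
    qed
  qed
qed

section \<open>The zonal kernel\<close>

definition mexican_kernel :: "nat \<Rightarrow> real \<Rightarrow> real \<Rightarrow> real" where
  "mexican_kernel s R u = (\<Sum>l. mexican_weight s ((real l + 1/2) / R) * (real l + 1/2) * leg l u)"

text \<open>In the Taylor expansions to the right and to the left of \<open>t\<close> the
  first-order terms cancel. The two remainders are taken at different points, so \<open>M\<close>
  has to bound \<open>f''\<close> on the whole interval.\<close>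

lemma second_difference_le:
  fixes f f' f'' :: "real \<Rightarrow> real"
  assumes f: "\<And>x. (f has_real_derivative f' x) (at x)" and f': "\<And>x. (f' has_real_derivative f'' x) (at x)"
    and h: "h > 0" and M: "\<And>y. \<bar>y - t\<bar> \<le> h \<Longrightarrow> \<bar>f'' y\<bar> \<le> M"
  shows "\<bar>f (t + h) - 2 * f t + f (t - h)\<bar> \<le> M * h\<^sup>2"
proof -
  define df where "df = (\<lambda>m::nat. if m = 0 then f else if m = 1 then f' else f'')"
  have df: "\<forall>m x. m < 2 \<and> a \<le> x \<and> x \<le> b \<longrightarrow> DERIV (df m) x :> df (Suc m) x" for a b
    using f f' by (auto simp: df_def less_2_cases_iff)
  have df0: "df 0 = f" by (simp add: df_def)
  have "\<exists>y. t < y \<and> y < t + h \<and> f (t + h) = (\<Sum>m<2. (df m t / fact m) * (t + h - t) ^ m) + (df 2 y / fact 2) * (t + h - t)\<^sup>2"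
    by (rule Taylor_up[OF _ df0 df]) (use h in auto)
  then obtain y where y: "t < y" "y < t + h" "f (t + h) = (\<Sum>m<2. (df m t / fact m) * (t + h - t) ^ m) + (df 2 y / fact 2) * (t + h - t)\<^sup>2"
    by blast
  have "\<exists>z. t - h < z \<and> z < t \<and> f (t - h) = (\<Sum>m<2. (df m t / fact m) * (t - h - t) ^ m) + (df 2 z / fact 2) * (t - h - t)\<^sup>2"
    by (rule Taylor_down[OF _ df0 df]) (use h in auto)
  then obtain z where z: "t - h < z" "z < t" "f (t - h) = (\<Sum>m<2. (df m t / fact m) * (t - h - t) ^ m) + (df 2 z / fact 2) * (t - h - t)\<^sup>2"
    by blast
  have "f (t + h) - 2 * f t + f (t - h) = (f'' y + f'' z) / 2 * h\<^sup>2"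
    using y(3) z(3) by (simp add: df_def eval_nat_numeral algebra_simps)
  also have "\<bar>\<dots>\<bar> = \<bar>f'' y + f'' z\<bar> / 2 * h\<^sup>2"
    by (simp add: abs_mult)
  also have "\<dots> \<le> M * h\<^sup>2"
  proof (intro mult_right_mono)
    have "\<bar>f'' y\<bar> \<le> M" "\<bar>f'' z\<bar> \<le> M"
      using y z h by (auto intro!: M)
    moreover have "\<bar>a + b\<bar> / 2 \<le> m" if "\<bar>a\<bar> \<le> m" "\<bar>b\<bar> \<le> m" for a b m :: real
      using that by argo
    ultimately show "\<bar>f'' y + f'' z\<bar> / 2 \<le> M" by blast
  qed auto
  finally show ?thesis .
qed

text \<open>The decay profile varies by a bounded factor over bounded distances. This moves the
  intermediate points of Taylor's and the mean value theorem back to the centre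
  \<open>t\<close>.\<close>

lemma decay_translate:
  fixes t y h h0 :: real
  assumes "\<bar>y - t\<bar> \<le> h" "h \<le> h0"
  shows "1 / (1 + y\<^sup>2)\<^sup>2 \<le> (2 + 2 * h0\<^sup>2)\<^sup>2 / (1 + t\<^sup>2)\<^sup>2"
proof -
  have p: "1 + x\<^sup>2 > 0" for x :: real using zero_le_power2[of x] by linarith
  have "(t - y)\<^sup>2 \<le> h0\<^sup>2"
    using assms by (intro power2_le_iff_abs_le[THEN iffD2]) auto
  moreover have "t\<^sup>2 \<le> 2 * y\<^sup>2 + 2 * (t - y)\<^sup>2"
    using zero_le_power2[of "2 * y - t"] by (simp add: power2_eq_square algebra_simps)
  ultimately have "1 + t\<^sup>2 \<le> 1 + 2 * y\<^sup>2 + 2 * h0\<^sup>2"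
    by linarith
  also have "\<dots> \<le> (2 + 2 * h0\<^sup>2) * (1 + y\<^sup>2)"
    using mult_nonneg_nonneg[of "h0\<^sup>2" "y\<^sup>2"] by (simp add: algebra_simps)
  finally have "(1 + t\<^sup>2)\<^sup>2 \<le> (2 + 2 * h0\<^sup>2)\<^sup>2 * (1 + y\<^sup>2)\<^sup>2"
    using p[of t] unfolding power_mult_distrib[symmetric] by (intro power_mono) auto
  moreover have "(1 + y\<^sup>2)\<^sup>2 > 0" "(1 + t\<^sup>2)\<^sup>2 > 0" by (intro zero_less_power p)+
  moreover have "1 / Y \<le> q / T" if "T \<le> q * Y" "Y > 0" "T > 0" for Y T q :: real
    using that by (simp add: field_simps)
  ultimately show ?thesis by blast
qed

text \<open>With \<open>x = l + 1/2\<close>, \<open>h = 1 / R\<close> and \<open>t = x * h\<close>,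
  the coefficient is minus one half of the sum of \<open>x\<close> times the second difference and
  half the central first difference. The second derivative makes the former \<open>O(x h^2)\<close>.
  The latter has the same order because the first derivative carries a factor of size
  \<open>t = x * h\<close>. The lower bound on \<open>R\<close> keeps the step \<open>h\<close>
  bounded.\<close>

lemma mexican_coefficient_difference_le:
  assumes s: "s \<ge> 1" and r0: "r0 > 0"
  obtains C where "C > 0" "\<And>R l. R \<ge> r0 \<Longrightarrow>
    \<bar>(real l * (mexican_weight s ((real l + 1/2) / R) - mexican_weight s ((real (l - 1) + 1/2) / R))
     - real (Suc l) * (mexican_weight s ((real (Suc l) + 1/2) / R) - mexican_weight s ((real l + 1/2) / R))) / 2\<bar>
    \<le> C / R\<^sup>2 * ((real l + 1/2) / (1 + ((real l + 1/2) / R)\<^sup>2)\<^sup>2)"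
proof -
  obtain D where D: "D > 0" "\<And>t. \<bar>mexican_weight' s t\<bar> \<le> \<bar>t\<bar> * (D / (1 + t\<^sup>2)\<^sup>2)"
    "\<And>t. \<bar>mexican_weight'' s t\<bar> \<le> D / (1 + t\<^sup>2)\<^sup>2"
    using mexican_weight_bounds[OF s] by metis
  define q where "q = (2 + 2 * (1 / r0)\<^sup>2)\<^sup>2"
  have "2 + 2 * (1 / r0)\<^sup>2 > 0" by (intro add_pos_nonneg) auto
  then have q: "q > 0" by (simp add: q_def)
  show ?thesis
  proof (rule that)
    show "2 * D * q > 0" using D q by simp
    fix R :: real and l :: nat
    assume R: "R \<ge> r0"
    let ?f = "mexican_weight s"
    define h x t where "h = 1 / R" and "x = real l + 1/2" and "t = x / R"
    have h: "h > 0" "h \<le> 1 / r0" using R r0 by (auto simp: h_def field_simps)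
    have x: "x > 0" "x \<ge> 1/2" by (auto simp: x_def)
    have t: "t = x * h" by (simp add: t_def h_def)
    define Q where "Q = D * q / (1 + t\<^sup>2)\<^sup>2"
    have Q: "D / (1 + y\<^sup>2)\<^sup>2 \<le> Q" if "\<bar>y - t\<bar> \<le> h" for y
      using mult_left_mono[OF decay_translate[OF that h(2)], of D] D(1) by (simp add: Q_def q_def)
    have Q0: "Q \<ge> 0" using D(1) q by (simp add: Q_def)
    have d2: "\<bar>?f (t + h) - 2 * ?f t + ?f (t - h)\<bar> \<le> Q * h\<^sup>2"
      by (rule second_difference_le[OF mexican_weight_deriv[OF s] mexican_weight'_deriv[OF s] h(1)])
        (use D(3) Q order_trans in blast)
    have d1: "\<bar>?f (t + h) - ?f (t - h)\<bar> \<le> 6 * x * h\<^sup>2 * Q"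
    proof -
      obtain y where y: "t - h < y" "y < t + h" "?f (t + h) - ?f (t - h) = (t + h - (t - h)) * mexican_weight' s y"
        using MVT2[of "t - h" "t + h" ?f "mexican_weight' s"] mexican_weight_deriv[OF s] h(1) by auto
      \<comment> \<open>The point \<open>y\<close> may be negative. Since \<open>x\<close> is at
        least 1/2, \<open>h\<close> is at most \<open>2 * t\<close>, so \<open>y\<close> lies
        between \<open>- t\<close> and \<open>3 * t\<close>.\<close>
      have "(1/2) * h \<le> x * h" using x h by (intro mult_right_mono) auto
      then have "\<bar>y\<bar> \<le> 3 * t" using y(1,2) h(1) unfolding t by linarith
      moreover have "D / (1 + y\<^sup>2)\<^sup>2 \<le> Q" using y by (intro Q) auto
      ultimately have "\<bar>y\<bar> * (D / (1 + y\<^sup>2)\<^sup>2) \<le> 3 * t * Q"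
        using D(1) t x h by (intro mult_mono) auto
      with D(2)[of y] have "\<bar>mexican_weight' s y\<bar> \<le> 3 * t * Q" by linarith
      then have "2 * h * \<bar>mexican_weight' s y\<bar> \<le> 2 * h * (3 * t * Q)"
        using h by (intro mult_left_mono) auto
      then show ?thesis using y(3) h by (simp add: abs_mult t power2_eq_square mult_ac)
    qed
    have tp: "(real (Suc l) + 1/2) / R = t + h"
      by (simp add: t_def h_def x_def add_divide_distrib)
    \<comment> \<open>At \<open>l = 0\<close> the truncated predecessor does not correspond to
      \<open>t - h\<close>; the factor \<open>real l\<close> hides the discrepancy.\<close>
    have tm: "real l * ?f ((real (l - 1) + 1/2) / R) = real l * ?f (t - h)"
      by (cases l) (simp_all add: t_def h_def x_def add_divide_distrib add.commute)
    have "(real l * (?f ((real l + 1/2) / R) - ?f ((real (l - 1) + 1/2) / R))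
     - real (Suc l) * (?f ((real (Suc l) + 1/2) / R) - ?f ((real l + 1/2) / R))) / 2
     = - (x * (?f (t + h) - 2 * ?f t + ?f (t - h)) + (?f (t + h) - ?f (t - h)) / 2) / 2"
      unfolding tp right_diff_distrib tm x_def[symmetric] t_def[symmetric]
      by (simp add: x_def field_simps)
    also have "\<bar>\<dots>\<bar> \<le> (x * (Q * h\<^sup>2) + (6 * x * h\<^sup>2 * Q) / 2) / 2"
    proof -
      have "\<bar>x * (?f (t + h) - 2 * ?f t + ?f (t - h))\<bar> \<le> x * (Q * h\<^sup>2)"
        using d2 x by (simp add: abs_mult)
      moreover have "\<bar>- (p + q / 2) / 2\<bar> \<le> (P + Q / 2) / 2" if "\<bar>p\<bar> \<le> P" "\<bar>q\<bar> \<le> Q" for p q P Q :: real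
        using that by argo
      ultimately show ?thesis using d1 by blast
    qed
    also have "\<dots> = 2 * D * q / R\<^sup>2 * (x / (1 + t\<^sup>2)\<^sup>2)"
      by (simp add: Q_def h_def power_divide)
    finally show "\<bar>(real l * (?f ((real l + 1/2) / R) - ?f ((real (l - 1) + 1/2) / R))
     - real (Suc l) * (?f ((real (Suc l) + 1/2) / R) - ?f ((real l + 1/2) / R))) / 2\<bar>
       \<le> 2 * D * q / R\<^sup>2 * ((real l + 1/2) / (1 + ((real l + 1/2) / R)\<^sup>2)\<^sup>2)"
      unfolding x_def t_def .
  qed
qed

text \<open>One majorant yields all three claims: squaring it and dividing by \<open>l + 1/2\<close>
  gives \<open>(l + 1/2) / P^2\<close> with \<open>P\<close> at least 1, so the sum of squares
  reduces to the same telescoped sum as the sum of absolute values.\<close>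

lemma sum_square_weight_le:
  assumes R: "R > 0" and C: "C \<ge> 0"
    and d: "\<And>l. \<bar>d l\<bar> \<le> C * ((real l + 1/2) / (1 + ((real l + 1/2) / R)\<^sup>2)\<^sup>2)"
  shows "summable (\<lambda>l. \<bar>d l\<bar>)" and "(\<Sum>l<n. (d l)\<^sup>2 / (real l + 1/2)) \<le> C\<^sup>2 * (2 * R\<^sup>2)"
    and "(\<Sum>l. \<bar>d l\<bar>) \<le> C * (2 * R\<^sup>2)"
proof -
  let ?w = "\<lambda>l. (real l + 1/2) / (1 + ((real l + 1/2) / R)\<^sup>2)\<^sup>2"
  have sw: "summable (\<lambda>l. C * ?w l)" by (intro summable_mult summable_reciprocal_square R)
  show s: "summable (\<lambda>l. \<bar>d l\<bar>)"
    by (rule summable_comparison_test'[OF sw, of 0]) (use d in simp)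
  have "(\<Sum>l. ?w l) \<le> 2 * R\<^sup>2"
    by (intro suminf_le_const summable_reciprocal_square sum_reciprocal_square_le R)
  then have "C * (\<Sum>l. ?w l) \<le> C * (2 * R\<^sup>2)" using C by (intro mult_left_mono)
  moreover have "(\<Sum>l. \<bar>d l\<bar>) \<le> (\<Sum>l. C * ?w l)"
    by (intro suminf_le d s sw)
  ultimately show "(\<Sum>l. \<bar>d l\<bar>) \<le> C * (2 * R\<^sup>2)"
    using suminf_mult[OF summable_reciprocal_square[OF R], of C] by linarith
  have "(d l)\<^sup>2 / (real l + 1/2) \<le> C\<^sup>2 * ?w l" for l
  proof -
    define x P where "x = real l + 1/2" and "P = (1 + (x / R)\<^sup>2)\<^sup>2"
    have x: "x > 0" and P: "P \<ge> 1" by (simp_all add: x_def P_def)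
    have "(d l)\<^sup>2 \<le> (C * (x / P))\<^sup>2"
      using d[of l] unfolding x_def[symmetric] P_def[symmetric]
      using abs_ge_zero[of "d l"] by (simp only: abs_le_square_iff[symmetric])
    then have "(d l)\<^sup>2 / x \<le> (C * (x / P))\<^sup>2 / x" using x by (intro divide_right_mono) auto
    also have "\<dots> = C\<^sup>2 * (x / (P * P))" using x by (simp add: power2_eq_square field_simps)
    also have "\<dots> \<le> C\<^sup>2 * (x / P)"
      using x P by (intro mult_left_mono divide_left_mono) auto
    finally show ?thesis unfolding P_def x_def .
  qed
  then have "(\<Sum>l<n. (d l)\<^sup>2 / (real l + 1/2)) \<le> (\<Sum>l<n. C\<^sup>2 * ?w l)"
    by (intro sum_mono)
  also have "\<dots> = C\<^sup>2 * (\<Sum>l<n. ?w l)" by (simp add: sum_distrib_left)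
  also have "\<dots> \<le> C\<^sup>2 * (2 * R\<^sup>2)"
    by (intro mult_left_mono sum_reciprocal_square_le R) auto
  finally show "(\<Sum>l<n. (d l)\<^sup>2 / (real l + 1/2)) \<le> C\<^sup>2 * (2 * R\<^sup>2)" .
qed

text \<open>The weight \<open>1 + R\<^sup>2 (1 - u)\<close> makes both factors integrable: its inverse square has integral
  at most \<open>R\<^sup>-\<^sup>2\<close>, and the weighted kernel is controlled in \<open>L\<^sup>2\<close> by the second differences of
  the coefficients.  Cauchy--Schwarz then appears as the pointwise inequality \<open>2 |K| \<le> R\<^sup>2 w\<^sup>-\<^sup>2 + R\<^sup>-\<^sup>2 w\<^sup>2 K\<^sup>2\<close>.\<close>

lemma integral_abs_le_weighted:
  fixes K :: "real \<Rightarrow> real"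
  assumes R: "R > 0" and K: "continuous_on {-1..1} K"
    and 0: "integral {-1..1} (\<lambda>u. (K u)\<^sup>2) \<le> A * R\<^sup>2"
    and 1: "integral {-1..1} (\<lambda>u. ((1 - u) * K u)\<^sup>2) \<le> B / R\<^sup>2"
  shows "integral {-1..1} (\<lambda>u. \<bar>K u\<bar>) \<le> 1 / 2 + A + B"
proof -
  let ?w = "\<lambda>u. 1 + R\<^sup>2 * (1 - u)"
  have w: "?w u > 0" if "u \<in> {-1..1}" for u
    using that by (intro add_pos_nonneg mult_nonneg_nonneg) auto
  \<comment> \<open>The integrand is the exact derivative of \<open>1 / w\<close>, and
    \<open>w = 1\<close> at the endpoint 1, so the integral is at most 1.\<close>
  have w0: "((\<lambda>u. R\<^sup>2 / (?w u)\<^sup>2) has_integral 1 / ?w 1 - 1 / ?w (-1)) {-1..1}"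
  proof (rule fundamental_theorem_of_calculus)
    fix u :: real assume u: "u \<in> {-1..1}"
    have "?w u \<noteq> 0" using w[OF u] by simp
    then have "((\<lambda>u. 1 / ?w u) has_real_derivative R\<^sup>2 / (?w u)\<^sup>2) (at u within {-1..1})"
      by (auto intro!: derivative_eq_intros simp: power2_eq_square)
    then show "((\<lambda>u. 1 / ?w u) has_vector_derivative R\<^sup>2 / (?w u)\<^sup>2) (at u within {-1..1})"
      by (simp add: has_real_derivative_iff_has_vector_derivative)
  qed simp
  have int0: "(\<lambda>u. R\<^sup>2 / (?w u)\<^sup>2) integrable_on {-1..1}" using w0 by blast
  have le1: "integral {-1..1} (\<lambda>u. R\<^sup>2 / (?w u)\<^sup>2) \<le> 1"
    using w0 w[of "-1"] by (simp add: integral_unique)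
  have int1: "(\<lambda>u. (K u)\<^sup>2) integrable_on {-1..1}" "(\<lambda>u. ((1 - u) * K u)\<^sup>2) integrable_on {-1..1}"
    "(\<lambda>u. \<bar>K u\<bar>) integrable_on {-1..1}"
    by (intro integrable_continuous_real continuous_intros K)+
  have "integral {-1..1} (\<lambda>u. \<bar>K u\<bar>) \<le>
      integral {-1..1} (\<lambda>u. (1/2) * (R\<^sup>2 / (?w u)\<^sup>2) + (1 / R\<^sup>2 * (K u)\<^sup>2 + R\<^sup>2 * ((1 - u) * K u)\<^sup>2))"
  proof (intro integral_le int1 integrable_add integrable_on_mult_right int0)
    fix u :: real assume u: "u \<in> {-1..1}"
    define W where "W = ?w u"
    have W: "W > 0" using w[OF u] by (simp add: W_def)
    have "0 \<le> (R / W - W / R * \<bar>K u\<bar>)\<^sup>2" by simp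
    also have "\<dots> = R\<^sup>2 / W\<^sup>2 - 2 * \<bar>K u\<bar> + W\<^sup>2 / R\<^sup>2 * (K u)\<^sup>2"
      using W R by (simp add: power2_diff power_divide power_mult_distrib)
    finally have "\<bar>K u\<bar> \<le> (1/2) * (R\<^sup>2 / W\<^sup>2) + (1/2) * (W\<^sup>2 / R\<^sup>2 * (K u)\<^sup>2)" by linarith
    \<comment> \<open>Splitting the squared weight leaves exactly the two squared L2 norms that the
      hypotheses bound.\<close>
    also have "W\<^sup>2 \<le> 2 + 2 * (R\<^sup>2 * (1 - u))\<^sup>2"
      unfolding W_def using zero_le_power2[of "1 - R\<^sup>2 * (1 - u)"] by (simp add: power2_diff power2_sum)
    then have "(1/2) * (W\<^sup>2 / R\<^sup>2 * (K u)\<^sup>2) \<le> (1/2) * ((2 + 2 * (R\<^sup>2 * (1 - u))\<^sup>2) / R\<^sup>2 * (K u)\<^sup>2)"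
      by (intro mult_left_mono mult_right_mono divide_right_mono) auto
    also have "\<dots> = 1 / R\<^sup>2 * (K u)\<^sup>2 + R\<^sup>2 * ((1 - u) * K u)\<^sup>2"
      using R by (simp add: field_simps power2_eq_square)
    finally show "\<bar>K u\<bar> \<le> (1/2) * (R\<^sup>2 / (?w u)\<^sup>2) + (1 / R\<^sup>2 * (K u)\<^sup>2 + R\<^sup>2 * ((1 - u) * K u)\<^sup>2)"
      by (simp add: W_def)
  qed
  also have "\<dots> = (1/2) * integral {-1..1} (\<lambda>u. R\<^sup>2 / (?w u)\<^sup>2) +
      (1 / R\<^sup>2 * integral {-1..1} (\<lambda>u. (K u)\<^sup>2) + R\<^sup>2 * integral {-1..1} (\<lambda>u. ((1 - u) * K u)\<^sup>2))"
    by (simp only: integral_add integral_mult_right integrable_add integrable_on_mult_right int0 int1)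
  also have "\<dots> \<le> (1/2) * 1 + (1 / R\<^sup>2 * (A * R\<^sup>2) + R\<^sup>2 * (B / R\<^sup>2))"
    by (intro add_mono mult_left_mono le1 0 1) auto
  also have "\<dots> = 1 / 2 + A + B" using R by simp
  finally show ?thesis .
qed

text \<open>\<open>sum_square_weight_le\<close> is used twice: for the coefficients of the kernel
  with constant \<open>D\<close>, and for those of \<open>1 - u\<close> times the kernel with
  constant \<open>E / R^2\<close>. The resulting squared L2 bounds \<open>2 D^2 R^2\<close> and
  \<open>2 E^2 / R^2\<close> are what \<open>integral_abs_le_weighted\<close> expects.\<close>

lemma mexican_kernel_upper:
  assumes s: "s \<ge> 1" and r0: "r0 > 0"
  obtains C where "C > 0"
    "\<And>R. R \<ge> r0 \<Longrightarrow> continuous_on {-1..1} (mexican_kernel s R)"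
    "\<And>R u. R \<ge> r0 \<Longrightarrow> u \<in> {-1..1} \<Longrightarrow> \<bar>mexican_kernel s R u\<bar> \<le> C * R\<^sup>2"
    "\<And>R. R \<ge> r0 \<Longrightarrow> integral {-1..1} (\<lambda>u. \<bar>mexican_kernel s R u\<bar>) \<le> C"
proof -
  obtain D where D: "D > 0" "\<And>t. 0 \<le> mexican_weight s t" "\<And>t. mexican_weight s t \<le> D / (1 + t\<^sup>2)\<^sup>2"
    using mexican_weight_bounds[OF s] by metis
  obtain E where E: "E > 0" "\<And>R l. R \<ge> r0 \<Longrightarrow>
    \<bar>(real l * (mexican_weight s ((real l + 1/2) / R) - mexican_weight s ((real (l - 1) + 1/2) / R))
     - real (Suc l) * (mexican_weight s ((real (Suc l) + 1/2) / R) - mexican_weight s ((real l + 1/2) / R))) / 2\<bar>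
    \<le> E / R\<^sup>2 * ((real l + 1/2) / (1 + ((real l + 1/2) / R)\<^sup>2)\<^sup>2)"
    using mexican_coefficient_difference_le[OF s r0] by metis
  define a where "a = (\<lambda>R l. mexican_weight s ((real l + 1/2) / R))"
  define d where "d = (\<lambda>R l. (real l * (a R l - a R (l - 1)) - real (Suc l) * (a R (Suc l) - a R l)) / 2)"
  have K: "mexican_kernel s R = (\<lambda>u. \<Sum>l. (a R l * (real l + 1/2)) * leg l u)" for R
    by (simp add: mexican_kernel_def a_def fun_eq_iff)
  have al: "\<bar>a R l * (real l + 1/2)\<bar> \<le> D * ((real l + 1/2) / (1 + ((real l + 1/2) / R)\<^sup>2)\<^sup>2)" for R l
  proof -
    have "a R l * (real l + 1/2) \<le> D / (1 + ((real l + 1/2) / R)\<^sup>2)\<^sup>2 * (real l + 1/2)"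
      unfolding a_def by (intro mult_right_mono D(3)) auto
    then show ?thesis using D(2) by (simp add: a_def)
  qed
  have dl: "\<bar>d R l\<bar> \<le> E / R\<^sup>2 * ((real l + 1/2) / (1 + ((real l + 1/2) / R)\<^sup>2)\<^sup>2)" if "R \<ge> r0" for R l
    using E(2)[OF that] unfolding d_def a_def .
  define C where "C = 2 * D + (1 / 2 + 2 * D\<^sup>2 + 2 * E\<^sup>2)"
  show ?thesis
  proof (rule that)
    show "C > 0" using D(1) unfolding C_def by (intro add_pos_pos add_pos_nonneg) auto
    fix R :: real assume R: "R \<ge> r0"
    then have R0: "R > 0" using r0 by simp
    note sa = sum_square_weight_le[OF R0 less_imp_le[OF D(1)] al]
    have ER: "E / R\<^sup>2 \<ge> 0" using E(1) by simp
    note sd = sum_square_weight_le[OF R0 ER dl[OF R]]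
    show cont: "continuous_on {-1..1} (mexican_kernel s R)"
      unfolding K by (rule continuous_on_legendre_series[OF sa(1)])
    show "\<bar>mexican_kernel s R u\<bar> \<le> C * R\<^sup>2" if u: "u \<in> {-1..1}" for u
    proof -
      have b: "norm (a R l * (real l + 1/2) * leg l u) \<le> \<bar>a R l * (real l + 1/2)\<bar>" for l
        using abs_legendre_le_1[OF u, of l] by (simp add: abs_mult mult_left_le)
      have s: "summable (\<lambda>l. norm (a R l * (real l + 1/2) * leg l u))"
        by (rule summable_comparison_test'[OF sa(1), of 0]) (use b in simp)
      have "norm (\<Sum>l. a R l * (real l + 1/2) * leg l u) \<le> (\<Sum>l. \<bar>a R l * (real l + 1/2)\<bar>)"
        by (rule order_trans[OF summable_norm[OF s] suminf_le[OF b s sa(1)]])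
      also have "\<dots> \<le> D * (2 * R\<^sup>2)" by (rule sa(3))
      also have "\<dots> \<le> C * R\<^sup>2"
        unfolding C_def distrib_right using D(1) by (simp add: algebra_simps)
      finally show ?thesis by (simp add: K)
    qed
    have "integral {-1..1} (\<lambda>u. (mexican_kernel s R u)\<^sup>2) \<le> D\<^sup>2 * (2 * R\<^sup>2)"
      unfolding K by (rule integral_legendre_series_sq_le[OF sa(1,2)])
    then have 0: "integral {-1..1} (\<lambda>u. (mexican_kernel s R u)\<^sup>2) \<le> (2 * D\<^sup>2) * R\<^sup>2"
      by simp
    have sa': "summable (\<lambda>l. \<bar>a R l\<bar> * (real l + 1/2))"
      using sa(1) by (simp add: abs_mult)
    have "integral {-1..1} (\<lambda>u. ((1 - u) * mexican_kernel s R u)\<^sup>2) =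
        integral {-1..1} (\<lambda>u. (\<Sum>l. d R l * leg l u)\<^sup>2)"
      by (intro integral_cong) (simp only: K d_def legendre_series_mult_one_minus[OF sa'])
    also have "\<dots> \<le> (E / R\<^sup>2)\<^sup>2 * (2 * R\<^sup>2)"
      by (rule integral_legendre_series_sq_le[OF sd(1,2)])
    also have "\<dots> = (2 * E\<^sup>2) / R\<^sup>2"
      using R0 by (simp add: field_simps power2_eq_square)
    finally have "integral {-1..1} (\<lambda>u. \<bar>mexican_kernel s R u\<bar>) \<le> 1 / 2 + 2 * D\<^sup>2 + 2 * E\<^sup>2"
      using integral_abs_le_weighted[OF R0 cont 0] by simp
    also have "\<dots> \<le> C" using D(1) by (simp add: C_def)
    finally show "integral {-1..1} (\<lambda>u. \<bar>mexican_kernel s R u\<bar>) \<le> C" .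
  qed
qed

text \<open>Replacing each Legendre polynomial by its lower bound loses at most \<open>1 - u\<close>
  times the sum of \<open>a l * (x l)^3\<close>. Since \<open>a l * (x l)^2\<close> is
  \<open>R^2\<close> times the weight of index \<open>s + 1\<close>, that sum is
  \<open>O(R^4)\<close>; on a sufficiently small cap of the right scale the main term, of order
  \<open>R^2\<close>, survives.\<close>

lemma mexican_kernel_lower:
  assumes s: "s \<ge> 1" and r0: "r0 > 0"
  obtains c \<delta> where "c > 0" "\<delta> > 0"
    "\<And>R u. R \<ge> r0 \<Longrightarrow> u \<in> {-1..1} \<Longrightarrow> 1 - u \<le> \<delta> / R\<^sup>2 \<Longrightarrow> c * R\<^sup>2 \<le> mexican_kernel s R u"
proof -
  obtain D where D: "D > 0" "\<And>t. 0 \<le> mexican_weight s t" "\<And>t. mexican_weight s t \<le> D / (1 + t\<^sup>2)\<^sup>2"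
    using mexican_weight_bounds[OF s] by metis
  obtain E where E: "E > 0" "\<And>t. 0 \<le> mexican_weight (Suc s) t" "\<And>t. mexican_weight (Suc s) t \<le> E / (1 + t\<^sup>2)\<^sup>2"
    using mexican_weight_bounds[of "Suc s"] by (metis le_SucI s)
  \<comment> \<open>Now \<open>\<alpha> * R\<close> is at least 1, so rounding it up to
    \<open>m\<close> at most doubles it. The \<open>m\<close> indices from \<open>m\<close> to
    \<open>2 * m - 1\<close> then have \<open>x l\<close> between \<open>\<alpha> * R\<close> and
    \<open>4 * \<alpha> * R\<close>, which is where the powers of \<open>\<alpha>\<close> and the
    exponent of \<open>c\<close> come from.\<close>
  define \<alpha> where "\<alpha> = 1 / r0"
  have \<alpha>: "\<alpha> > 0" using r0 by (simp add: \<alpha>_def)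
  define c where "c = \<alpha>\<^sup>2 * (\<alpha> ^ (2 * s) * exp (- ((4 * \<alpha>)\<^sup>2)))"
  have c: "c > 0" using \<alpha> by (simp add: c_def)
  \<comment> \<open>Chosen so that the bound \<open>2 * E * \<delta> * R^2\<close> for the loss is
    half of \<open>c * R^2\<close>.\<close>
  define \<delta> where "\<delta> = c / (4 * E)"
  have \<delta>: "\<delta> > 0" using c E by (simp add: \<delta>_def)
  show ?thesis
  proof (rule that)
    show "c / 2 > 0" using c by simp
    show "\<delta> > 0" by fact
    fix R u :: real assume R: "R \<ge> r0" and u: "u \<in> {-1..1}" and u': "1 - u \<le> \<delta> / R\<^sup>2"
    have R0: "R > 0" using R r0 by simp
    define x where "x = (\<lambda>l::nat. real l + 1/2)"
    define a where "a = (\<lambda>l. mexican_weight s (x l / R))"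
    define b where "b = (\<lambda>l. R\<^sup>2 * (mexican_weight (Suc s) (x l / R) * x l))"
    have x: "x l > 0" for l by (simp add: x_def)
    have xl: "real l + 1/2 = x l" for l by (simp add: x_def)
    have "\<bar>a l * x l\<bar> \<le> D * (x l / (1 + (x l / R)\<^sup>2)\<^sup>2)" for l
      using mult_right_mono[OF D(3)[of "x l / R"], of "x l"] D(2) x[of l] by (simp add: a_def)
    note sa = sum_square_weight_le[OF R0 less_imp_le[OF D(1)] this[unfolded x_def]]
    have "\<bar>b l\<bar> \<le> (E * R\<^sup>2) * (x l / (1 + (x l / R)\<^sup>2)\<^sup>2)" for l
      using mult_left_mono[OF mult_right_mono[OF E(3)[of "x l / R"], of "x l"], of "R\<^sup>2"] E(2) x[of l]
      by (simp add: b_def mult_ac)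
    note sb = sum_square_weight_le[OF R0 _ this[unfolded x_def]]
    have ER: "0 \<le> E * R\<^sup>2" using E(1) by simp
    have abs_ax: "\<bar>a l * x l\<bar> = a l * x l" and abs_b: "\<bar>b l\<bar> = b l" for l
      using D(2) E(2) x[of l] by (simp_all add: a_def b_def)
    have sum_a: "summable (\<lambda>l. a l * x l)" using sa(1) unfolding xl abs_ax .
    have sum_b: "summable b" and b_le: "suminf b \<le> E * R\<^sup>2 * (2 * R\<^sup>2)"
      using sb(1,3)[OF ER] unfolding abs_b by auto
    have ax0: "0 \<le> a l * x l" for l using abs_ax[of l] by linarith
    have b0: "0 \<le> b l" for l using abs_b[of l] by linarith
    have ax3: "a l * x l * (x l)\<^sup>2 = b l" for l
      using R0 by (simp add: a_def b_def mexican_weight_def power_divide power_add field_simps power2_eq_square)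
    have term_le: "a l * x l - (1 - u) * b l \<le> a l * x l * leg l u" for l
    proof -
      have "a l * x l * (1 - (x l)\<^sup>2 * (1 - u)) \<le> a l * x l * leg l u"
        using legendre_ge[OF u, of l] x[of l] D(2) unfolding xl
        by (intro mult_left_mono) (auto simp: a_def)
      then show ?thesis by (simp add: ax3[symmetric] algebra_simps)
    qed
    have sum_leg: "summable (\<lambda>l. a l * x l * leg l u)"
    proof (rule summable_comparison_test'[OF sum_a])
      show "norm (a l * x l * leg l u) \<le> a l * x l" for l
        using mult_left_mono[OF abs_legendre_le_1[OF u, of l] abs_ge_zero, of "a l * x l"]
        unfolding real_norm_def abs_mult[of "a l * x l"] abs_ax by simp
    qed
    have "suminf (\<lambda>l. a l * x l) - (1 - u) * suminf b = (\<Sum>l. a l * x l - (1 - u) * b l)"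
      by (simp only: suminf_diff[OF sum_a summable_mult[OF sum_b], symmetric] suminf_mult[OF sum_b])
    also have "\<dots> \<le> (\<Sum>l. a l * x l * leg l u)"
      by (intro suminf_le term_le summable_diff summable_mult sum_a sum_b sum_leg)
    finally have 1: "suminf (\<lambda>l. a l * x l) - (1 - u) * suminf b \<le> mexican_kernel s R u"
      by (simp add: mexican_kernel_def a_def x_def)
    have 2: "(1 - u) * suminf b \<le> c / 2 * R\<^sup>2"
    proof -
      have "(1 - u) * suminf b \<le> (\<delta> / R\<^sup>2) * (E * R\<^sup>2 * (2 * R\<^sup>2))"
        using u u' b_le \<delta> b0 by (intro mult_mono suminf_nonneg sum_b) auto
      also have "\<dots> = c / 2 * R\<^sup>2" using R0 E(1) by (simp add: \<delta>_def field_simps)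
      finally show ?thesis .
    qed
    have 3: "c * R\<^sup>2 \<le> suminf (\<lambda>l. a l * x l)"
    proof -
      define m where "m = nat \<lceil>\<alpha> * R\<rceil>"
      have aR: "\<alpha> * R \<ge> 1" using R r0 by (simp add: \<alpha>_def)
      have m: "\<alpha> * R \<le> real m" "real m \<le> 2 * (\<alpha> * R)"
        using aR unfolding m_def by linarith+
      have "\<alpha> * R * (\<alpha> ^ (2 * s) * exp (- ((4 * \<alpha>)\<^sup>2))) \<le> a l * x l" if l: "l \<in> {m..<2 * m}" for l
      proof -
        have xl: "\<alpha> * R \<le> x l" "x l \<le> 4 * (\<alpha> * R)"
          using l m by (auto simp: x_def)
        then have t: "\<alpha> \<le> x l / R" "x l / R \<le> 4 * \<alpha>"
          using R0 by (simp_all add: field_simps)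
        have "(x l / R)\<^sup>2 \<le> (4 * \<alpha>)\<^sup>2" using t \<alpha> by (intro power_mono) auto
        then have "\<alpha> ^ (2 * s) * exp (- ((4 * \<alpha>)\<^sup>2)) \<le> a l"
          unfolding a_def mexican_weight_def using t \<alpha> by (intro mult_mono power_mono) auto
        then show ?thesis
          using xl \<alpha> R0 D(2) mult_mono[of "\<alpha> * R" "x l" "\<alpha> ^ (2 * s) * exp (- ((4 * \<alpha>)\<^sup>2))" "a l"] x[of l]
          by (simp add: mult.commute)
      qed
      then have "real (card {m..<2 * m}) * (\<alpha> * R * (\<alpha> ^ (2 * s) * exp (- ((4 * \<alpha>)\<^sup>2)))) \<le> (\<Sum>l\<in>{m..<2 * m}. a l * x l)"
        by (rule sum_bounded_below)
      moreover have "card {m..<2 * m} = m"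
        by simp
      ultimately have "real m * (\<alpha> * R * (\<alpha> ^ (2 * s) * exp (- ((4 * \<alpha>)\<^sup>2)))) \<le> (\<Sum>l\<in>{m..<2 * m}. a l * x l)"
        by (simp only:)
      also have "\<dots> \<le> suminf (\<lambda>l. a l * x l)"
        by (intro sum_le_suminf sum_a ax0) auto
      finally have "real m * (\<alpha> * R * (\<alpha> ^ (2 * s) * exp (- ((4 * \<alpha>)\<^sup>2)))) \<le> suminf (\<lambda>l. a l * x l)" .
      moreover have "(\<alpha> * R) * (\<alpha> * R * (\<alpha> ^ (2 * s) * exp (- ((4 * \<alpha>)\<^sup>2)))) \<le> real m * (\<alpha> * R * (\<alpha> ^ (2 * s) * exp (- ((4 * \<alpha>)\<^sup>2))))"
        using m \<alpha> R0 by (intro mult_right_mono) auto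
      moreover have "(\<alpha> * R) * (\<alpha> * R * (\<alpha> ^ (2 * s) * exp (- ((4 * \<alpha>)\<^sup>2)))) = c * R\<^sup>2"
        by (simp add: c_def power2_eq_square)
      ultimately show ?thesis by linarith
    qed
    show "c / 2 * R\<^sup>2 \<le> mexican_kernel s R u"
      using 1 2 3 by simp
  qed
qed

section \<open>Zonal integrals over the sphere\<close>

text \<open>Space is split as a line times the complex plane, so that Fubini's theorem along the
  first axis meets slices that are discs of known area.\<close>

definition prod_to_vec3 :: "real \<times> complex \<Rightarrow> real^3" where
  "prod_to_vec3 p = vector [fst p, Re (snd p), Im (snd p)]"

lemma prod_to_vec3_nth [simp]:
  "prod_to_vec3 p $ 1 = fst p" "prod_to_vec3 p $ 2 = Re (snd p)" "prod_to_vec3 p $ 3 = Im (snd p)"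
  by (simp_all add: prod_to_vec3_def)

lemma norm_prod_to_vec3: "norm (prod_to_vec3 p) = sqrt ((fst p)\<^sup>2 + (norm (snd p))\<^sup>2)"
  by (simp add: norm_vec_def L2_set_def sum_3 cmod_power2 add.assoc)

lemma prod_to_vec3_measurable [measurable]: "prod_to_vec3 \<in> borel_measurable borel"
proof (rule borel_measurable_continuous_onI)
  have "continuous_on UNIV (\<lambda>p. \<chi> i. prod_to_vec3 p $ i)"
  proof (intro continuous_on_vec_lambda)
    fix i :: 3
    show "continuous_on UNIV (\<lambda>p. prod_to_vec3 p $ i)"
      using exhaust_3[of i]
      by (elim disjE; simp; intro continuous_on_Re continuous_on_Im continuous_on_fst continuous_on_snd continuous_on_id)
  qed
  then show "continuous_on UNIV prod_to_vec3" by simp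
qed

lemma box_Pair: "box (a, c) (b, d) = box a b \<times> box c d"
  by (auto simp: box_def Basis_prod_def ball_Un)

text \<open>Lebesgue measure is determined by the volumes of boxes, and the preimage of a box is a
  product of boxes.\<close>

lemma lborel_vec3: "lborel = distr lborel borel prod_to_vec3"
proof (rule lborel_eqI)
  fix l u :: "real^3"
  assume le: "\<And>b. b \<in> Basis \<Longrightarrow> l \<bullet> b \<le> u \<bullet> b"
  have nth_le: "l $ i \<le> u $ i" for i
    using le[of "axis i 1"] by (simp add: inner_axis axis_in_Basis_iff)
  let ?l = "Complex (l $ 2) (l $ 3)" and ?u = "Complex (u $ 2) (u $ 3)"
  have "prod_to_vec3 -` box l u = box (l $ 1, ?l) (u $ 1, ?u)"
    by (auto simp: mem_box_cart forall_3 box_Pair in_box_complex_iff box_real)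
  then have "emeasure (distr lborel borel prod_to_vec3) (box l u) =
      emeasure (lborel \<Otimes>\<^sub>M lborel) (box (l $ 1) (u $ 1) \<times> box ?l ?u)"
    by (simp add: emeasure_distr lborel_prod box_Pair)
  also have "\<dots> = emeasure lborel (box (l $ 1) (u $ 1)) * emeasure lborel (box ?l ?u)"
    by (intro lborel.emeasure_pair_measure_Times) auto
  also have "\<dots> = ennreal (u $ 1 - l $ 1) * ennreal ((u $ 2 - l $ 2) * (u $ 3 - l $ 3))"
    using nth_le by (simp add: emeasure_lborel_box_eq Basis_complex_def inner_complex_def)
  also have "\<dots> = ennreal ((u $ 1 - l $ 1) * ((u $ 2 - l $ 2) * (u $ 3 - l $ 3)))"
    by (rule ennreal_mult[symmetric]) (use nth_le in auto)
  also have "(u $ 1 - l $ 1) * ((u $ 2 - l $ 2) * (u $ 3 - l $ 3)) = (\<Prod>i\<in>UNIV. (u - l) $ i)"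
    unfolding UNIV_3 by simp
  also have "(\<Prod>i\<in>UNIV. (u - l) $ i) = (\<Prod>b\<in>Basis. (u - l) \<bullet> b)"
  proof -
    have B: "Basis = range (\<lambda>i::3. axis i (1::real))"
      by (auto simp: Basis_vec_def)
    have I: "inj (\<lambda>i::3. axis i (1::real))"
      by (simp add: inj_on_def axis_eq_axis)
    show ?thesis
      unfolding B prod.reindex[OF I] by (simp add: inner_axis)
  qed
  finally show "emeasure (distr lborel borel prod_to_vec3) (box l u) = (\<Prod>b\<in>Basis. (u - l) \<bullet> b)" .
qed simp

text \<open>The definition of the measure turns the cap into a solid sector with apex at the origin.
  For positive \<open>c\<close> its slices at fixed height are discs, bounded by the cone below
  height \<open>c\<close> and by the sphere above it.\<close>

lemma emeasure_sphere_measure_cap_axis: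
  assumes c: "0 < c" "c < 1"
  shows "emeasure sphere_measure {x \<in> sphere 0 1. c < x $ 1} = ennreal (2 * pi * (1 - c))"
proof -
  \<comment> \<open>The squared radius of the slice at height \<open>z\<close>: the sphere
    contributes the first entry, the cone the second, and they cross at
    \<open>z = c\<close>.\<close>
  define g where "g = (\<lambda>z. min (1 - z\<^sup>2) (z\<^sup>2 * (1 / c\<^sup>2 - 1)))"
  let ?S = "{x :: real^3. norm x < 1 \<and> c * norm x < x $ 1}"
  have cc: "1 / c\<^sup>2 \<ge> 1" using c by (simp add: power_le_one)
  have slice: "{w. norm (prod_to_vec3 (z, w)) < 1 \<and> c * norm (prod_to_vec3 (z, w)) < z} =
      (if z \<in> {0..1} then ball 0 (sqrt (g z)) else {})" for z
  proof (cases "0 < z \<and> z \<le> 1")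
    case True
    have "norm (prod_to_vec3 (z, w)) < 1 \<and> c * norm (prod_to_vec3 (z, w)) < z \<longleftrightarrow> norm w < sqrt (g z)" for w
    proof -
      have "c * sqrt (z\<^sup>2 + (norm w)\<^sup>2) < z \<longleftrightarrow> sqrt (c\<^sup>2 * (z\<^sup>2 + (norm w)\<^sup>2)) < sqrt (z\<^sup>2)"
        using True c by (simp add: real_sqrt_mult)
      also have "\<dots> \<longleftrightarrow> c\<^sup>2 * (z\<^sup>2 + (norm w)\<^sup>2) < z\<^sup>2"
        by (rule real_sqrt_less_iff)
      also have "\<dots> \<longleftrightarrow> (norm w)\<^sup>2 < z\<^sup>2 * (1 / c\<^sup>2 - 1)"
        using c by (simp add: field_simps)
      finally have 1: "c * sqrt (z\<^sup>2 + (norm w)\<^sup>2) < z \<longleftrightarrow> (norm w)\<^sup>2 < z\<^sup>2 * (1 / c\<^sup>2 - 1)" .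
      have 2: "sqrt (z\<^sup>2 + (norm w)\<^sup>2) < 1 \<longleftrightarrow> (norm w)\<^sup>2 < 1 - z\<^sup>2"
        by (auto simp: real_sqrt_lt_1_iff)
      have "norm w < sqrt (g z) \<longleftrightarrow> sqrt ((norm w)\<^sup>2) < sqrt (g z)" by simp
      also have "\<dots> \<longleftrightarrow> (norm w)\<^sup>2 < g z" by (rule real_sqrt_less_iff)
      finally show ?thesis
        unfolding norm_prod_to_vec3 fst_conv snd_conv 1 2 by (auto simp: g_def)
    qed
    then show ?thesis using True by (auto simp: ball_def dist_norm)
  next
    case False
    have *: "0 \<le> c * norm (prod_to_vec3 (z, w))" "z \<le> norm (prod_to_vec3 (z, w))" for w
      using c component_le_norm_cart[of "prod_to_vec3 (z, w)" 1] by auto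
    have "\<not> (norm (prod_to_vec3 (z, w)) < 1 \<and> c * norm (prod_to_vec3 (z, w)) < z)" for w
      using False *[of w] by argo
    then have "{w. norm (prod_to_vec3 (z, w)) < 1 \<and> c * norm (prod_to_vec3 (z, w)) < z} = {}"
      by blast
    \<comment> \<open>Height 0 falls under this case: there \<open>g\<close> vanishes, so the open
      disc is empty.\<close>
    moreover have "(if z \<in> {0..1} then ball 0 (sqrt (g z)) else {}) = ({} :: complex set)"
      using False by (auto simp: g_def)
    ultimately show ?thesis by (simp only:)
  qed
  have g_nonneg: "0 \<le> g z" if "z \<in> {0..1}" for z
    using that cc by (auto simp: g_def power_le_one intro!: mult_nonneg_nonneg)
  have area: "emeasure lborel {w. norm (prod_to_vec3 (z, w)) < 1 \<and> c * norm (prod_to_vec3 (z, w)) < z} =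
      indicator {0..1} z * ennreal (pi * g z)" for z
    unfolding slice using g_nonneg[of z]
    by (auto simp: emeasure_ball unit_ball_vol_2 indicator_def)
  have gI: "((\<lambda>z. pi * g z) has_integral pi * (2 / 3 * (1 - c))) {0..1}"
  proof -
    have "((\<lambda>z. z\<^sup>2 * (1 / c\<^sup>2 - 1)) has_integral (c ^ 3 / 3 * (1 / c\<^sup>2 - 1) - 0 ^ 3 / 3 * (1 / c\<^sup>2 - 1))) {0..c}"
      using c by (intro fundamental_theorem_of_calculus)
        (auto simp: has_real_derivative_iff_has_vector_derivative[symmetric] intro!: derivative_eq_intros)
    moreover have "g z = z\<^sup>2 * (1 / c\<^sup>2 - 1)" if "z \<in> {0..c}" for z
    proof -
      have "z\<^sup>2 \<le> c\<^sup>2" using that by (intro power_mono) auto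
      then have "z\<^sup>2 / c\<^sup>2 \<le> 1" using c by simp
      then show ?thesis by (simp add: g_def min_def algebra_simps)
    qed
    moreover have "c ^ 3 / 3 * (1 / c\<^sup>2 - 1) - 0 ^ 3 / 3 * (1 / c\<^sup>2 - 1) = (c - c ^ 3) / 3"
      using c by (simp add: field_simps power2_eq_square power3_eq_cube)
    ultimately have 1: "(g has_integral (c - c ^ 3) / 3) {0..c}"
      by (metis (no_types, lifting) has_integral_eq)
    have "((\<lambda>z. 1 - z\<^sup>2) has_integral ((1 - 1 ^ 3 / 3) - (c - c ^ 3 / 3))) {c..1}"
      using c by (intro fundamental_theorem_of_calculus)
        (auto simp: has_real_derivative_iff_has_vector_derivative[symmetric] intro!: derivative_eq_intros)
    moreover have "g z = 1 - z\<^sup>2" if "z \<in> {c..1}" for z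
    proof -
      have "c\<^sup>2 \<le> z\<^sup>2" using that c by (intro power_mono) auto
      then have "z\<^sup>2 / c\<^sup>2 \<ge> 1" using c by simp
      then show ?thesis by (simp add: g_def min_def algebra_simps)
    qed
    ultimately have 2: "(g has_integral ((1 - 1 ^ 3 / 3) - (c - c ^ 3 / 3))) {c..1}"
      by (metis (no_types, lifting) has_integral_eq)
    have "(g has_integral (c - c ^ 3) / 3 + ((1 - 1 ^ 3 / 3) - (c - c ^ 3 / 3))) {0..1}"
      using c by (intro has_integral_combine[OF _ _ 1 2]) auto
    also have "(c - c ^ 3) / 3 + ((1 - 1 ^ 3 / 3) - (c - c ^ 3 / 3)) = 2 / 3 * (1 - c)"
      by (simp add: field_simps)
    finally show ?thesis by (rule has_integral_mult_right)
  qed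
  have Sm: "?S \<in> sets borel" by measurable
  have "emeasure lborel ?S = emeasure lborel (prod_to_vec3 -` ?S)"
    by (subst lborel_vec3, subst emeasure_distr) (use Sm in auto)
  also have "\<dots> = emeasure (lborel \<Otimes>\<^sub>M lborel) (prod_to_vec3 -` ?S)"
    by (simp add: lborel_prod)
  also have "\<dots> = (\<integral>\<^sup>+z. emeasure lborel (Pair z -` (prod_to_vec3 -` ?S)) \<partial>lborel)"
  proof (rule lborel.emeasure_pair_measure_alt)
    show "prod_to_vec3 -` ?S \<in> sets (lborel \<Otimes>\<^sub>M lborel)"
      unfolding lborel_prod using measurable_sets[OF prod_to_vec3_measurable Sm] by simp
  qed
  also have "\<dots> = (\<integral>\<^sup>+z. indicator {0..1} z * ennreal (pi * g z) \<partial>lborel)"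
    by (intro nn_integral_cong) (use area in \<open>simp add: vimage_def\<close>)
  also have "\<dots> = (\<integral>\<^sup>+z. ennreal (indicator {0..1} z * (pi * g z)) \<partial>lborel)"
    by (intro nn_integral_cong) (auto simp: indicator_def)
  also have "\<dots> = ennreal (pi * (2 / 3 * (1 - c)))"
    by (intro nn_integral_has_integral_lebesgue gI mult_nonneg_nonneg g_nonneg) auto
  finally have vol: "emeasure lborel ?S = \<dots>" .
  have eq: "{x \<in> ball 0 1 - {0}. sgn x \<in> {x \<in> sphere 0 1. c < x $ 1}} = ?S"
  proof -
    have "c < (sgn x) $ 1 \<longleftrightarrow> c * norm x < x $ 1" if "x \<noteq> 0" for x :: "real^3"
      using that by (simp add: sgn_div_norm field_simps)
    then show ?thesis by (auto simp: norm_sgn)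
  qed
  have m: "{x \<in> sphere 0 1. c < x $ 1} \<in> sets (borel :: (real^3) measure)"
    by measurable
  have "emeasure sphere_measure {x \<in> sphere 0 1. c < x $ 1} = 3 * ennreal (pi * (2 / 3 * (1 - c)))"
    by (subst emeasure_sphere_measure_borel[OF m], blast) (simp only: eq vol)
  also have "\<dots> = ennreal (2 * pi * (1 - c))"
    using c by (subst ennreal_numeral[symmetric], subst ennreal_mult[symmetric]) auto
  finally show ?thesis .
qed

section \<open>Caps about arbitrary axes and projection onto an axis\<close>

lemma finite_measure_sphere_measure: "finite_measure sphere_measure"
  by (rule finite_measureI) (simp add: emeasure_sphere_measure_sphere)

lemma inner_measurable_sphere_measure [measurable]: "(\<lambda>x. x \<bullet> \<xi>) \<in> borel_measurable sphere_measure"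
  unfolding sphere_measure_def
  by (intro measurable_completion) (simp only: measurable_distr_eq1, intro measurable_restrict_space1, measurable)

lemma emeasure_sphere_measure_inner_rotation:
  assumes "norm \<xi> = 1" "norm \<eta> = 1" "A \<in> sets borel"
  shows "emeasure sphere_measure {x \<in> sphere 0 1. x \<bullet> \<xi> \<in> A} = emeasure sphere_measure {x \<in> sphere 0 1. x \<bullet> \<eta> \<in> A}"
proof -
  obtain T where T: "orthogonal_transformation T" "T \<eta> = \<xi>"
    using orthogonal_transformation_exists[of \<eta> \<xi>] assms by auto
  have "{x \<in> sphere 0 1. x \<bullet> \<xi> \<in> A} = T ` {x \<in> sphere 0 1. x \<bullet> \<eta> \<in> A}"
  proof (intro set_eqI iffI)
    fix y assume y: "y \<in> {x \<in> sphere 0 1. x \<bullet> \<xi> \<in> A}"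
    obtain x where x: "y = T x"
      using orthogonal_transformation_bij[OF T(1)] by (metis bij_pointE)
    show "y \<in> T ` {x \<in> sphere 0 1. x \<bullet> \<eta> \<in> A}"
      using y T orthogonal_transformation_norm[OF T(1)]
      by (auto simp: x orthogonal_transformation_def intro!: imageI)
  qed (use T orthogonal_transformation_norm[OF T(1)] in \<open>auto simp: orthogonal_transformation_def\<close>)
  moreover have "{x \<in> sphere 0 1. x \<bullet> \<eta> \<in> A} \<in> sets borel"
    using assms(3) by measurable
  ultimately show ?thesis
    by (simp only:) (rule emeasure_sphere_measure_rotation[OF T(1)], auto)
qed

text \<open>The direct computation covers heights strictly between 0 and 1. A cap of negative height
  is the complement of a closed cap about \<open>- \<xi>\<close>, so closed caps are measured as
  well, by approximation from outside. The hemisphere is squeezed between caps of small positive and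
  negative height.\<close>

lemma emeasure_sphere_measure_cap:
  fixes \<xi> :: "real^3"
  assumes \<xi>: "norm \<xi> = 1" and c: "c \<in> {-1..1}"
  shows "emeasure sphere_measure {x \<in> sphere 0 1. c < x \<bullet> \<xi>} = ennreal (2 * pi * (1 - c))"
proof -
  interpret finite_measure sphere_measure by (rule finite_measure_sphere_measure)
  let ?m = "\<lambda>\<xi> A. measure sphere_measure {x \<in> sphere 0 1. x \<bullet> \<xi> \<in> A}"
  have sets: "{x \<in> sphere 0 1. x \<bullet> \<xi> \<in> A} \<in> sets sphere_measure" if "A \<in> sets borel" for \<xi> A
    by (rule sets_borel_sphere_measure) (use that in \<open>auto intro!: measurable_sets_borel simp: Collect_conj_eq, measurable\<close>)
  have total: "measure sphere_measure (sphere 0 1) = 4 * pi"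
    by (simp add: measure_def emeasure_sphere_measure_sphere)
  have pos: "?m \<xi> {c<..} = 2 * pi * (1 - c)" if "0 < c" "c < 1" "norm \<xi> = 1" for c \<xi>
    using emeasure_sphere_measure_inner_rotation[of \<xi> "axis 1 1" "{c<..}"]
      emeasure_sphere_measure_cap_axis[OF that(1,2)] that
    by (simp add: inner_axis measure_def)
  have mono: "?m \<xi> A \<le> ?m \<xi> B" if "A \<subseteq> B" "A \<in> sets borel" "B \<in> sets borel" for A B \<xi>
    using that by (intro finite_measure_mono sets) auto
  have ge1: "?m \<xi> {1<..} = 0" if "norm \<xi> = 1" for \<xi>
  proof -
    have "x \<bullet> \<xi> \<le> 1" if "norm x = 1" for x
      using norm_cauchy_schwarz[of x \<xi>] \<open>norm \<xi> = 1\<close> that by simp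
    then have "{x \<in> sphere 0 1. x \<bullet> \<xi> \<in> {1<..}} = {}" by (auto simp: not_less[symmetric])
    then show ?thesis by (simp only:) simp
  qed
  have pos1: "?m \<xi> {c<..} = 2 * pi * (1 - c)" if "0 < c" "c \<le> 1" "norm \<xi> = 1" for c \<xi>
  proof (cases "c = 1")
    case False
    then show ?thesis using pos that by simp
  qed (use ge1 that in simp)
  have closed: "?m \<xi> {c..} = 2 * pi * (1 - c)" if "0 < c" "c \<le> 1" "norm \<xi> = 1" for c \<xi>
  proof (rule antisym)
    have "?m \<xi> {c..} \<le> 2 * pi * (1 - b)" if "0 < b" "b < c" for b
    proof -
      have "{c..} \<subseteq> {b<..}" using that by auto
      from mono[OF this, of \<xi>] show ?thesis
        using pos1[of b \<xi>] that \<open>c \<le> 1\<close> \<open>norm \<xi> = 1\<close> by simp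
    qed
    then have "?m \<xi> {c..} \<le> 2 * pi * (1 - c) + e" if "e > 0" for e
    proof -
      \<comment> \<open>The maximum keeps \<open>b\<close> positive, where the open-cap formula is
        available, while the area grows by at most \<open>e\<close>.\<close>
      define b where "b = max (c / 2) (c - e / (2 * pi))"
      have b: "0 < b" "b < c" "b \<ge> c - e / (2 * pi)" using \<open>0 < c\<close> \<open>e > 0\<close> by (auto simp: b_def)
      have "2 * pi * (1 - b) \<le> 2 * pi * (1 - (c - e / (2 * pi)))"
        using b(3) by (intro mult_left_mono) auto
      also have "\<dots> = 2 * pi * (1 - c) + e" by (simp add: field_simps)
      finally show ?thesis using \<open>\<And>b. 0 < b \<Longrightarrow> b < c \<Longrightarrow> _\<close>[OF b(1,2)] by linarith
    qed
    then show "?m \<xi> {c..} \<le> 2 * pi * (1 - c)" by (rule field_le_epsilon)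
    show "2 * pi * (1 - c) \<le> ?m \<xi> {c..}"
    proof -
      have "{c<..} \<subseteq> {c..}" by auto
      from mono[OF this, of \<xi>] show ?thesis using pos1[of c \<xi>] that by simp
    qed
  qed
  have neg: "?m \<xi> {c<..} = 2 * pi * (1 - c)" if "-1 \<le> c" "c < 0" "norm \<xi> = 1" for c \<xi>
  proof -
    have "?m \<xi> {c<..} = measure sphere_measure (sphere 0 1 - {x \<in> sphere 0 1. x \<bullet> \<xi> \<in> {..c}})"
      by (intro arg_cong[where f = "measure sphere_measure"]) auto
    also have "\<dots> = 4 * pi - ?m \<xi> {..c}"
    proof -
      have S: "sphere 0 1 \<in> sets sphere_measure"
        using sets.top[of sphere_measure] by simp
      have sub: "{x \<in> sphere 0 1. x \<bullet> \<xi> \<in> {..c}} \<subseteq> sphere 0 1"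
        by auto
      have "{..c} \<in> sets borel"
        by simp
      from finite_measure_Diff[OF S sets[OF this] sub] show ?thesis
        unfolding total .
    qed
    also have "{x \<in> sphere 0 1. x \<bullet> \<xi> \<in> {..c}} = {x \<in> sphere 0 1. x \<bullet> (-\<xi>) \<in> {-c..}}"
      by auto
    also have "measure sphere_measure \<dots> = 2 * pi * (1 - (-c))"
      using that by (intro closed) auto
    finally show ?thesis by (simp add: algebra_simps)
  qed
  have zero: "?m \<xi> {0<..} = 2 * pi"
  proof (rule antisym; rule field_le_epsilon)
    fix e :: real assume e: "e > 0"
    define b where "b = min 1 (e / (2 * pi))"
    have b: "0 < b" "b \<le> 1" "2 * pi * b \<le> e" using e by (auto simp: b_def min_def field_simps)
    have sub: "{0<..} \<subseteq> {-b<..}" "{b<..} \<subseteq> {0<..}" using b by auto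
    show "?m \<xi> {0<..} \<le> 2 * pi + e"
      using mono[OF sub(1), of \<xi>] neg[of "-b" \<xi>] b \<xi> by (simp add: algebra_simps)
    show "2 * pi \<le> ?m \<xi> {0<..} + e"
      using mono[OF sub(2), of \<xi>] pos1[of b \<xi>] b \<xi> by (simp add: algebra_simps)
  qed
  have "?m \<xi> {c<..} = 2 * pi * (1 - c)"
    using pos1[of c \<xi>] neg[of c \<xi>] zero c \<xi> by (cases c "0 :: real" rule: linorder_cases) auto
  then show ?thesis
    by (simp add: emeasure_eq_measure)
qed

text \<open>Archimedes' hat-box theorem. Finite measures on the line that agree on all open right
  half-lines coincide, and the half-lines pull back to caps.\<close>

lemma distr_sphere_measure_inner:
  fixes \<xi> :: "real^3"
  assumes \<xi>: "norm \<xi> = 1"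
  shows "distr sphere_measure borel (\<lambda>x. x \<bullet> \<xi>) = density lborel (\<lambda>u. ennreal (2 * pi) * indicator {-1..1} u)"
    (is "?N = ?M")
proof (rule measure_eqI_lessThan)
  have bd: "\<bar>x \<bullet> \<xi>\<bar> \<le> 1" if "norm x = 1" for x
    using Cauchy_Schwarz_ineq2[of x \<xi>] \<xi> that by simp
  have N: "emeasure ?N {c<..} = emeasure sphere_measure {x \<in> sphere 0 1. c < x \<bullet> \<xi>}" for c
    by (subst emeasure_distr) (auto intro!: arg_cong[where f = "emeasure sphere_measure"])
  have M: "emeasure ?M {c<..} = ennreal (2 * pi) * emeasure lborel ({c<..} \<inter> {-1..1})" for c
    by (subst emeasure_density)
      (auto simp: nn_integral_cmult mult.assoc indicator_inter_arith[symmetric] Int_commute)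
  show "emeasure ?N {c<..} = emeasure ?M {c<..}" for c
  proof -
    consider "c > 1" | "c < -1" | "c \<in> {-1..1}" by fastforce
    then show ?thesis
    proof cases
      case 1
      then have "{x \<in> sphere 0 1. c < x \<bullet> \<xi>} = {}" "{c<..} \<inter> {-1..1} = {}" using bd by fastforce+
      then show ?thesis unfolding N M by (simp only:) simp
    next
      case 2
      then have "{x \<in> sphere 0 1. c < x \<bullet> \<xi>} = sphere 0 1" "{c<..} \<inter> {-1..1} = {-1..1}" using bd by fastforce+
      moreover have "ennreal (4 * pi) = ennreal (2 * pi) * ennreal (1 - (-1))"
        by (subst ennreal_mult[symmetric]) auto
      ultimately show ?thesis unfolding N M
        by (simp only: emeasure_sphere_measure_sphere emeasure_lborel_Icc)
    next
      case 3
      then have "{c<..} \<inter> {-1..1} = {c<..1}" by auto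
      then show ?thesis unfolding N M emeasure_sphere_measure_cap[OF \<xi> 3]
        using 3 by (simp flip: ennreal_mult)
    qed
  qed
  show "emeasure ?N {c<..} < \<infinity>" for c
  proof -
    have "emeasure ?N {c<..} \<le> emeasure sphere_measure (space sphere_measure)"
      unfolding N by (rule emeasure_space)
    then show ?thesis by (auto simp: emeasure_sphere_measure_sphere top.not_eq_extremum order_le_less_trans)
  qed
qed auto

lemma nn_integral_sphere_measure_zonal:
  fixes \<xi> :: "real^3"
  assumes \<xi>: "norm \<xi> = 1" and [measurable]: "g \<in> borel_measurable borel"
  shows "(\<integral>\<^sup>+x. g (x \<bullet> \<xi>) \<partial>sphere_measure) = ennreal (2 * pi) * (\<integral>\<^sup>+u. indicator {-1..1} u * g u \<partial>lborel)"
proof -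
  have "(\<integral>\<^sup>+x. g (x \<bullet> \<xi>) \<partial>sphere_measure) = (\<integral>\<^sup>+u. g u \<partial>distr sphere_measure borel (\<lambda>x. x \<bullet> \<xi>))"
    by (subst nn_integral_distr) auto
  also have "\<dots> = (\<integral>\<^sup>+u. ennreal (2 * pi) * indicator {-1..1} u * g u \<partial>lborel)"
    unfolding distr_sphere_measure_inner[OF \<xi>] by (subst nn_integral_density) auto
  finally show ?thesis by (simp add: nn_integral_cmult mult.assoc)
qed

section \<open>Norms of the needlets\<close>

text \<open>Above, the p-th power is at most the sup bound to the power \<open>p - 1\<close> times
  \<open>\<bar>f x\<bar>\<close>; below, only the set \<open>A\<close> is kept. Both give the
  integral the size \<open>R^(p-2)\<close>, and \<open>(p - 2) / p = 1 - 2 / p\<close>.\<close>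

lemma Lp_norm_bounds:
  assumes f: "f \<in> borel_measurable M" and M: "finite_measure M"
    and R: "R > 0" and p: "p \<ge> 1" and C: "C1 > 0" "C2 > 0" "c1 > 0" "c2 > 0"
    and sup: "\<And>x. x \<in> space M \<Longrightarrow> \<bar>f x\<bar> \<le> C1 * R"
    and L1: "(\<integral>\<^sup>+x. ennreal \<bar>f x\<bar> \<partial>M) \<le> ennreal (C2 / R)"
    and A: "A \<in> sets M" "c2 / R\<^sup>2 \<le> measure M A" "\<And>x. x \<in> A \<Longrightarrow> c1 * R \<le> \<bar>f x\<bar>"
  shows "ennreal (c1 * c2 powr (1 / p) * R powr (1 - 2 / p)) \<le> Lp_norm M p f"
    and "Lp_norm M p f \<le> ennreal ((C1 powr (p - 1) * C2) powr (1 / p) * R powr (1 - 2 / p))"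
proof -
  interpret finite_measure M by fact
  note [measurable] = f
  have int1: "integrable M (\<lambda>x. \<bar>f x\<bar>)"
    using sup by (intro integrable_const_bound[where B = "C1 * R"]) auto
  have int: "integrable M (\<lambda>x. \<bar>f x\<bar> powr p)"
    using sup p by (intro integrable_const_bound[where B = "(C1 * R) powr p"]) (auto intro!: powr_mono2 AE_I2)
  have L1': "(\<integral>x. \<bar>f x\<bar> \<partial>M) \<le> C2 / R"
    using L1 C R by (subst (asm) nn_integral_eq_integral[OF int1]) (auto simp: ennreal_le_iff)
  let ?I = "\<integral>x. \<bar>f x\<bar> powr p \<partial>M"
  have norm: "Lp_norm M p f = ennreal (?I powr (1 / p))"
    using int by (simp add: Lp_norm_def)
  have I0: "?I \<ge> 0" by simp
  have e: "(R powr (p - 2)) powr (1 / p) = R powr (1 - 2 / p)"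
    using p by (simp add: powr_powr diff_divide_distrib)
  have "?I \<le> (\<integral>x. (C1 * R) powr (p - 1) * \<bar>f x\<bar> \<partial>M)"
  proof (intro integral_mono int integrable_mult_right int1)
    fix x assume x: "x \<in> space M"
    have "\<bar>f x\<bar> powr p = \<bar>f x\<bar> powr (p - 1) * \<bar>f x\<bar>"
      by (cases "f x = 0") (simp_all add: powr_diff)
    also have "\<dots> \<le> (C1 * R) powr (p - 1) * \<bar>f x\<bar>"
      using sup[OF x] p by (intro mult_right_mono powr_mono2) auto
    finally show "\<bar>f x\<bar> powr p \<le> (C1 * R) powr (p - 1) * \<bar>f x\<bar>" .
  qed
  also have "\<dots> \<le> (C1 * R) powr (p - 1) * (C2 / R)"
    using mult_left_mono[OF L1', of "(C1 * R) powr (p - 1)"] by simp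
  also have "\<dots> = C1 powr (p - 1) * C2 * R powr (p - 2)"
  proof -
    have "R powr (p - 1) / R = R powr (p - 2)"
      using R powr_diff[of R "p - 1" 1] by simp
    then show ?thesis using C R by (simp add: powr_mult field_simps)
  qed
  finally have "?I powr (1 / p) \<le> (C1 powr (p - 1) * C2 * R powr (p - 2)) powr (1 / p)"
    using p I0 by (intro powr_mono2) auto
  also have "\<dots> = (C1 powr (p - 1) * C2) powr (1 / p) * R powr (1 - 2 / p)"
    using C by (simp add: powr_mult e)
  finally show "Lp_norm M p f \<le> ennreal ((C1 powr (p - 1) * C2) powr (1 / p) * R powr (1 - 2 / p))"
    unfolding norm by (rule ennreal_leI)
  have "(c1 * R) powr p * (c2 / R\<^sup>2) \<le> (c1 * R) powr p * measure M A"
    using A(2) by (intro mult_left_mono) auto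
  also have "\<dots> = (\<integral>x. (c1 * R) powr p * indicator A x \<partial>M)"
    using A(1) by simp
  also have "\<dots> \<le> ?I"
  proof (intro integral_mono int)
    show "integrable M (\<lambda>x. (c1 * R) powr p * indicator A x)"
      using A(1) by (intro integrable_mult_right) (simp add: emeasure_eq_measure)
    fix x
    show "(c1 * R) powr p * indicator A x \<le> \<bar>f x\<bar> powr p"
      using A(3)[of x] C R p by (auto simp: indicator_def intro!: powr_mono2)
  qed
  finally have "(c1 * R) powr p * (c2 / R\<^sup>2) \<le> ?I" .
  moreover have "(c1 * R) powr p * (c2 / R\<^sup>2) = c1 powr p * c2 * R powr (p - 2)"
    using C R powr_diff[of R p 2] by (simp add: powr_mult powr_numeral)
  ultimately have "(c1 powr p * c2 * R powr (p - 2)) powr (1 / p) \<le> ?I powr (1 / p)"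
    using C p by (intro powr_mono2) auto
  moreover have "(c1 powr p * c2 * R powr (p - 2)) powr (1 / p) = c1 * c2 powr (1 / p) * R powr (1 - 2 / p)"
    using C p unfolding powr_mult e by (simp add: powr_powr)
  ultimately show "ennreal (c1 * c2 powr (1 / p) * R powr (1 - 2 / p)) \<le> Lp_norm M p f"
    unfolding norm by (intro ennreal_leI) simp
qed

text \<open>A set of positive measure cannot lie in the exceptional null set of the essential
  supremum, so the pointwise lower bound on \<open>A\<close> persists.\<close>

lemma Linf_norm_bounds:
  assumes f: "f \<in> borel_measurable M"
    and sup: "\<And>x. x \<in> space M \<Longrightarrow> \<bar>f x\<bar> \<le> C"
    and A: "A \<in> sets M" "0 < emeasure M A" "\<And>x. x \<in> A \<Longrightarrow> c \<le> \<bar>f x\<bar>"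
  shows "ennreal c \<le> Linf_norm M f" and "Linf_norm M f \<le> ennreal C"
proof -
  have [measurable]: "(\<lambda>x. ennreal \<bar>f x\<bar>) \<in> borel_measurable M" using f by measurable
  show "Linf_norm M f \<le> ennreal C"
    unfolding Linf_norm_def by (rule esssup_I, measurable) (auto intro!: AE_I2 ennreal_leI sup)
  show "ennreal c \<le> Linf_norm M f"
  proof (rule ccontr)
    assume "\<not> ennreal c \<le> Linf_norm M f"
    then have lt: "Linf_norm M f < ennreal c" by simp
    have "AE x in M. ennreal \<bar>f x\<bar> \<le> Linf_norm M f"
      unfolding Linf_norm_def by (rule esssup_AE)
    then have "AE x in M. x \<notin> A"
    proof eventually_elim
      case (elim x)
      show ?case
      proof
        assume "x \<in> A"
        then have "ennreal c \<le> ennreal \<bar>f x\<bar>" using A(3) by (intro ennreal_leI)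
        with elim lt show False by (meson leD order_trans)
      qed
    qed
    then have "emeasure M A = 0"
      using A(1) by (subst (asm) AE_iff_measurable[OF A(1)]) (use sets.sets_into_space[OF A(1)] in auto)
    with A(2) show False by simp
  qed
qed

lemma mexican_kernel_measurable [measurable]: "mexican_kernel s R \<in> borel_measurable borel"
proof -
  have [measurable]: "poly q \<in> borel_measurable borel" for q :: "real poly"
    by (intro borel_measurable_continuous_onI continuous_intros)
  show ?thesis unfolding mexican_kernel_def[abs_def] by measurable
qed

theorem corollary3p2:
  fixes B c\<^sub>B c' c'' :: real
    and N :: "int \<Rightarrow> nat"
    and E :: "int \<Rightarrow> nat \<Rightarrow> (real^3) set"
    and \<xi> :: "int \<Rightarrow> nat \<Rightarrow> real^3"
    and s :: nat
  assumes "B > 1" and "c\<^sub>B > 0" and "0 < c'" and "c' \<le> c''" and "s \<ge> 1"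
    and "\<And>j k. k \<in> {1..N j} \<Longrightarrow> E j k \<in> sets sphere_measure"
    and "\<And>j. disjoint_family_on (E j) {1..N j}"
    and "\<And>j. (\<Union>k\<in>{1..N j}. E j k) = sphere 0 1"
    and "\<And>j k. k \<in> {1..N j} \<Longrightarrow> diameter (E j k) \<le> c\<^sub>B * B powi (- j)"
    and "\<And>j k. k \<in> {1..N j} \<Longrightarrow> \<xi> j k \<in> E j k"
  shows
    "(\<forall>p\<ge>1. \<exists>c>0. \<exists>C>0. \<forall>j \<in> admissible_levels B c' c'' N E. \<forall>k\<in>{1..N j}.
        ennreal (c * B powr (2 * real_of_int j * (1/2 - 1/p)))
          \<le> Lp_norm sphere_measure p (mexican_needlet B s E \<xi> j k) \<and>
        Lp_norm sphere_measure p (mexican_needlet B s E \<xi> j k)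
          \<le> ennreal (C * B powr (2 * real_of_int j * (1/2 - 1/p)))) \<and>
     (\<exists>c>0. \<exists>C>0. \<forall>j \<in> admissible_levels B c' c'' N E. \<forall>k\<in>{1..N j}.
        ennreal (c * B powi j) \<le> Linf_norm sphere_measure (mexican_needlet B s E \<xi> j k) \<and>
        Linf_norm sphere_measure (mexican_needlet B s E \<xi> j k) \<le> ennreal (C * B powi j))"
proof -
  interpret finite_measure sphere_measure by (rule finite_measure_sphere_measure)
  \<comment> \<open>At an admissible level a region has area at least \<open>c' / R^2\<close> and at
    most \<open>4 * pi\<close>, which forces \<open>R\<close> to be at least
    \<open>r0\<close>.\<close>
  define r0 where "r0 = sqrt (c' / (4 * pi))"
  have r0: "r0 > 0" using assms(3) by (simp add: r0_def)
  obtain C where C: "C > 0"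
    "\<And>R. R \<ge> r0 \<Longrightarrow> continuous_on {-1..1} (mexican_kernel s R)"
    "\<And>R u. R \<ge> r0 \<Longrightarrow> u \<in> {-1..1} \<Longrightarrow> \<bar>mexican_kernel s R u\<bar> \<le> C * R\<^sup>2"
    "\<And>R. R \<ge> r0 \<Longrightarrow> integral {-1..1} (\<lambda>u. \<bar>mexican_kernel s R u\<bar>) \<le> C"
    by (rule mexican_kernel_upper[OF \<open>s \<ge> 1\<close> r0]) blast
  obtain c \<delta> where c: "c > 0" "\<delta> > 0"
    "\<And>R u. R \<ge> r0 \<Longrightarrow> u \<in> {-1..1} \<Longrightarrow> 1 - u \<le> \<delta> / R\<^sup>2 \<Longrightarrow> c * R\<^sup>2 \<le> mexican_kernel s R u"
    by (rule mexican_kernel_lower[OF \<open>s \<ge> 1\<close> r0]) blast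
  \<comment> \<open>The second entry keeps \<open>1 - \<eta> / R^2\<close> at least -1, inside the
    range of the cap formula.\<close>
  define \<eta> where "\<eta> = min \<delta> (2 * r0\<^sup>2)"
  have \<eta>: "\<eta> > 0" "\<eta> \<le> \<delta>" "\<eta> \<le> 2 * r0\<^sup>2" using c(2) r0 by (auto simp: \<eta>_def)
  \<comment> \<open>The square root of the area lies between \<open>sqrt c' / R\<close> and
    \<open>sqrt c'' / R\<close>, which lowers each power of \<open>R\<close> by one. In
    \<open>C2\<close> the normalisation \<open>1 / (2 * pi)\<close> cancels against the factor
    \<open>2 * pi\<close> of zonal integration, and \<open>c2 / R^2\<close> is the area of the
    cap.\<close>
  define C1 where "C1 = sqrt c'' / (2 * pi) * C"
  define C2 where "C2 = sqrt c'' * C"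
  define c1 where "c1 = sqrt c' / (2 * pi) * c"
  define c2 where "c2 = 2 * pi * \<eta>"
  have pos: "C1 > 0" "C2 > 0" "c1 > 0" "c2 > 0"
    using C(1) c(1) \<eta>(1) assms(3,4) by (simp_all add: C1_def C2_def c1_def c2_def)
  define A where "A = (\<lambda>j k. {x \<in> sphere 0 1. 1 - \<eta> / (B powi j)\<^sup>2 < x \<bullet> \<xi> j k})"
  have key: "B powi j > 0"
    "mexican_needlet B s E \<xi> j k \<in> borel_measurable sphere_measure"
    "\<And>x. x \<in> space sphere_measure \<Longrightarrow> \<bar>mexican_needlet B s E \<xi> j k x\<bar> \<le> C1 * B powi j"
    "(\<integral>\<^sup>+x. ennreal \<bar>mexican_needlet B s E \<xi> j k x\<bar> \<partial>sphere_measure) \<le> ennreal (C2 / B powi j)"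
    "A j k \<in> sets sphere_measure" "c2 / (B powi j)\<^sup>2 \<le> measure sphere_measure (A j k)"
    "\<And>x. x \<in> A j k \<Longrightarrow> c1 * B powi j \<le> \<bar>mexican_needlet B s E \<xi> j k x\<bar>"
    if j: "j \<in> admissible_levels B c' c'' N E" and k: "k \<in> {1..N j}" for j k
  proof -
    define R where "R = B powi j"
    define l where "l = measure sphere_measure (E j k)"
    show R0: "B powi j > 0" using assms(1) by simp
    then have R0': "R > 0" by (simp add: R_def)
    have "B powi (- 2 * j) = B powi (- (j * 2))"
      by (simp add: mult.commute)
    also have "\<dots> = 1 / R\<^sup>2"
      unfolding power_int_minus power_int_mult R_def by (simp add: divide_inverse)
    finally have l: "c' / R\<^sup>2 \<le> l" "l \<le> c'' / R\<^sup>2"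
      using j k by (auto simp: admissible_levels_def l_def)
    have "l \<le> measure sphere_measure (space sphere_measure)"
      unfolding l_def by (rule bounded_measure)
    also have "\<dots> = 4 * pi"
      by (simp add: measure_def emeasure_sphere_measure_sphere)
    finally have "c' / R\<^sup>2 \<le> 4 * pi" using l by simp
    then have "c' / (4 * pi) \<le> R\<^sup>2" using R0' by (simp add: field_simps)
    then have R: "r0 \<le> R" unfolding r0_def using R0' by (intro real_le_lsqrt) auto
    have "sqrt (c' / R\<^sup>2) \<le> sqrt l" "sqrt l \<le> sqrt (c'' / R\<^sup>2)"
      using l by (intro real_sqrt_le_mono; simp)+
    then have sl: "sqrt c' / R \<le> sqrt l" "sqrt l \<le> sqrt c'' / R"
      using R0' by (simp_all add: real_sqrt_divide)
    have "\<xi> j k \<in> sphere 0 1" using assms(8)[of j] assms(10)[OF k] k by blast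
    then have \<xi>: "norm (\<xi> j k) = 1" by simp
    have in_range: "x \<bullet> \<xi> j k \<in> {-1..1}" if "x \<in> sphere 0 1" for x
      using Cauchy_Schwarz_ineq2[of x "\<xi> j k"] \<xi> that by (auto simp: abs_le_iff)
    have needlet: "mexican_needlet B s E \<xi> j k = (\<lambda>x. sqrt l * (1 / (2 * pi)) * mexican_kernel s R (x \<bullet> \<xi> j k))"
      by (simp add: mexican_needlet_def mexican_kernel_def l_def R_def fun_eq_iff)
    have l0: "l \<ge> 0" by (simp add: l_def)
    show "mexican_needlet B s E \<xi> j k \<in> borel_measurable sphere_measure"
      unfolding needlet by measurable
    show "\<bar>mexican_needlet B s E \<xi> j k x\<bar> \<le> C1 * B powi j" if "x \<in> space sphere_measure" for x
    proof -
      have "\<bar>mexican_needlet B s E \<xi> j k x\<bar> = sqrt l * (1 / (2 * pi)) * \<bar>mexican_kernel s R (x \<bullet> \<xi> j k)\<bar>"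
        using l0 by (simp add: needlet abs_mult)
      also have "\<dots> \<le> (sqrt c'' / R) * (1 / (2 * pi)) * (C * R\<^sup>2)"
        using that R0' sl C(3)[OF R in_range] l0 assms(3,4) by (intro mult_mono) auto
      also have "\<dots> = C1 * R" using R0' by (simp add: C1_def power2_eq_square)
      finally show ?thesis by (simp add: R_def)
    qed
    show "A j k \<in> sets sphere_measure"
    proof -
      have "{x \<in> space sphere_measure. 1 - \<eta> / (B powi j)\<^sup>2 < x \<bullet> \<xi> j k} \<in> sets sphere_measure"
        by measurable
      then show ?thesis by (simp add: A_def)
    qed
    have \<eta>R: "\<eta> / R\<^sup>2 \<le> 2" "\<eta> / R\<^sup>2 > 0"
    proof -
      have "r0\<^sup>2 \<le> R\<^sup>2" using R r0 by (intro power_mono) auto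
      then show "\<eta> / R\<^sup>2 \<le> 2" using \<eta> R0' by (simp add: field_simps)
      show "\<eta> / R\<^sup>2 > 0" using \<eta> R0' by simp
    qed
    show "c2 / (B powi j)\<^sup>2 \<le> measure sphere_measure (A j k)"
      using emeasure_sphere_measure_cap[OF \<xi>, of "1 - \<eta> / R\<^sup>2"] \<eta>R \<eta>(1)
      by (simp add: A_def measure_def c2_def R_def)
    show "c1 * B powi j \<le> \<bar>mexican_needlet B s E \<xi> j k x\<bar>" if x: "x \<in> A j k" for x
    proof -
      have xs: "x \<in> sphere 0 1" and "1 - \<eta> / R\<^sup>2 < x \<bullet> \<xi> j k"
        using x by (auto simp: A_def R_def)
      moreover have "\<eta> / R\<^sup>2 \<le> \<delta> / R\<^sup>2" using \<eta> by (intro divide_right_mono) auto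
      ultimately have "c * R\<^sup>2 \<le> mexican_kernel s R (x \<bullet> \<xi> j k)"
        by (intro c(3)[OF R in_range]) auto
      then have "(sqrt c' / R) * (1 / (2 * pi)) * (c * R\<^sup>2) \<le> sqrt l * (1 / (2 * pi)) * mexican_kernel s R (x \<bullet> \<xi> j k)"
        using sl R0' c(1) l0 by (intro mult_mono) auto
      also have "(sqrt c' / R) * (1 / (2 * pi)) * (c * R\<^sup>2) = c1 * R"
        using R0' by (simp add: c1_def power2_eq_square)
      finally have "c1 * R \<le> mexican_needlet B s E \<xi> j k x"
        by (simp only: needlet)
      then show ?thesis by (simp add: R_def)
    qed
    have kint: "((\<lambda>u. \<bar>mexican_kernel s R u\<bar>) has_integral integral {-1..1} (\<lambda>u. \<bar>mexican_kernel s R u\<bar>)) {-1..1}"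
      by (intro integrable_integral integrable_continuous_real continuous_intros C(2) R)
    have "(\<integral>\<^sup>+x. ennreal \<bar>mexican_needlet B s E \<xi> j k x\<bar> \<partial>sphere_measure) =
        (\<integral>\<^sup>+x. ennreal (sqrt l * (1 / (2 * pi))) * ennreal \<bar>mexican_kernel s R (x \<bullet> \<xi> j k)\<bar> \<partial>sphere_measure)"
      using l0 by (intro nn_integral_cong) (simp add: needlet abs_mult ennreal_mult[symmetric])
    also have "\<dots> = ennreal (sqrt l * (1 / (2 * pi))) * (\<integral>\<^sup>+x. ennreal \<bar>mexican_kernel s R (x \<bullet> \<xi> j k)\<bar> \<partial>sphere_measure)"
      by (intro nn_integral_cmult) measurable
    also have "(\<integral>\<^sup>+x. ennreal \<bar>mexican_kernel s R (x \<bullet> \<xi> j k)\<bar> \<partial>sphere_measure) =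
        ennreal (2 * pi) * (\<integral>\<^sup>+u. indicator {-1..1} u * ennreal \<bar>mexican_kernel s R u\<bar> \<partial>lborel)"
      by (rule nn_integral_sphere_measure_zonal[OF \<xi>]) measurable
    also have "(\<integral>\<^sup>+u. indicator {-1..1} u * ennreal \<bar>mexican_kernel s R u\<bar> \<partial>lborel) =
        (\<integral>\<^sup>+u. ennreal (indicator {-1..1} u * \<bar>mexican_kernel s R u\<bar>) \<partial>lborel)"
      by (intro nn_integral_cong) (auto simp: indicator_def)
    also have "\<dots> = ennreal (integral {-1..1} (\<lambda>u. \<bar>mexican_kernel s R u\<bar>))"
      by (rule nn_integral_has_integral_lebesgue[OF _ kint]) auto
    also have "ennreal (sqrt l * (1 / (2 * pi))) * (ennreal (2 * pi) * \<dots>) \<le>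
       ennreal (sqrt c'' / R * (1 / (2 * pi))) * (ennreal (2 * pi) * ennreal C)"
      using sl C(4)[OF R] by (intro mult_mono mult_left_mono ennreal_leI mult_right_mono) auto
    also have "\<dots> = ennreal (C2 / R)"
      using R0' C(1) assms(3,4) by (simp add: C2_def ennreal_mult[symmetric] del: ennreal_mult)
    finally show "(\<integral>\<^sup>+x. ennreal \<bar>mexican_needlet B s E \<xi> j k x\<bar> \<partial>sphere_measure) \<le> ennreal (C2 / B powi j)"
      by (simp add: R_def)
  qed
  have exponent: "B powr (2 * real_of_int j * (1/2 - 1/p)) = (B powi j) powr (1 - 2 / p)" for j and p :: real
  proof -
    have "B powi j = B powr real_of_int j"
      using assms(1) by (subst powr_real_of_int') auto
    then have "(B powi j) powr (1 - 2 / p) = B powr (real_of_int j * (1 - 2 / p))"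
      by (simp add: powr_powr)
    then show ?thesis by (simp add: algebra_simps)
  qed
  show ?thesis
  proof (intro conjI allI impI)
    fix p :: real assume p: "p \<ge> 1"
    show "\<exists>c>0. \<exists>C>0. \<forall>j \<in> admissible_levels B c' c'' N E. \<forall>k\<in>{1..N j}.
        ennreal (c * B powr (2 * real_of_int j * (1/2 - 1/p)))
          \<le> Lp_norm sphere_measure p (mexican_needlet B s E \<xi> j k) \<and>
        Lp_norm sphere_measure p (mexican_needlet B s E \<xi> j k)
          \<le> ennreal (C * B powr (2 * real_of_int j * (1/2 - 1/p)))"
      unfolding exponent
    proof (intro exI conjI ballI)
      show "0 < c1 * c2 powr (1 / p)" and "0 < (C1 powr (p - 1) * C2) powr (1 / p)"
        using pos by simp_all
      fix j k assume jk: "j \<in> admissible_levels B c' c'' N E" "k \<in> {1..N j}"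
      note b = Lp_norm_bounds[OF key(2)[OF jk] finite_measure_axioms key(1)[OF jk] p pos key(3)[OF jk]
          key(4)[OF jk] key(5)[OF jk] key(6)[OF jk] key(7)[OF jk]]
      show "ennreal (c1 * c2 powr (1 / p) * (B powi j) powr (1 - 2 / p))
          \<le> Lp_norm sphere_measure p (mexican_needlet B s E \<xi> j k)"
        by (rule b(1))
      show "Lp_norm sphere_measure p (mexican_needlet B s E \<xi> j k)
          \<le> ennreal ((C1 powr (p - 1) * C2) powr (1 / p) * (B powi j) powr (1 - 2 / p))"
        by (rule b(2))
    qed
  next
    show "\<exists>c>0. \<exists>C>0. \<forall>j \<in> admissible_levels B c' c'' N E. \<forall>k\<in>{1..N j}.
        ennreal (c * B powi j) \<le> Linf_norm sphere_measure (mexican_needlet B s E \<xi> j k) \<and>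
        Linf_norm sphere_measure (mexican_needlet B s E \<xi> j k) \<le> ennreal (C * B powi j)"
    proof (intro exI conjI ballI)
      show "0 < c1" and "0 < C1" by (rule pos)+
      fix j k assume jk: "j \<in> admissible_levels B c' c'' N E" "k \<in> {1..N j}"
      have "0 < c2 / (B powi j)\<^sup>2" by (intro divide_pos_pos zero_less_power pos key(1)[OF jk])
      then have A: "0 < emeasure sphere_measure (A j k)"
        using key(6)[OF jk] by (simp add: emeasure_eq_measure)
      note b = Linf_norm_bounds[OF key(2)[OF jk] key(3)[OF jk] key(5)[OF jk] A key(7)[OF jk]]
      show "ennreal (c1 * B powi j) \<le> Linf_norm sphere_measure (mexican_needlet B s E \<xi> j k)"
        by (rule b(1))
      show "Linf_norm sphere_measure (mexican_needlet B s E \<xi> j k) \<le> ennreal (C1 * B powi j)"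
        by (rule b(2))
    qed
  qed
qed

end
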